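(* Assume that $J$ and $f$ satisfy the standing assumptions listed in the context, let $u(t,x)$ and $X(t)$ be the transition front and the function described in the context, and let $\Gamma_\alpha$ ($\alpha>0$) be the functions fixed in the context. (1) There is $\alpha_0>0$ such that for any $0<\alpha\le\alpha_0$ there are $\epsilon_0=\epsilon_0(\alpha)>0$, $\omega=\omega(\alpha)>0$ and $A=A(\alpha)>0$ with the following property. For any $u_0:\mathbb{R}\to[0,1]$ with $u_0\in C^b_{\rm unif}(\mathbb{R},\mathbb{R})$, if there exist $t_0\in\mathbb{R}$, $\epsilon\in(0,\epsilon_0]$ and $\zeta_0^\pm\in\mathbb{R}$ such that $$u(t_0,x-\zeta_0^-)-\epsilon\,\Gamma_\alpha(x-\zeta_0^--X(t_0))\le u_0(x)\le u(t_0,x-\zeta_0^+)+\epsilon\,\Gamma_\alpha(x-\zeta_0^+-X(t_0))$$ for all $x\in\mathbb{R}$, then $$u(t,x-\zeta^-(t))-q(t)\Gamma_\alpha(x-\zeta^-(t)-X(t))\le u(t,x;t_0,u_0)\le u(t,x-\zeta^+(t))+q(t)\Gamma_\alpha(x-\zeta^+(t)-X(t))$$ for all $x\in\mathbb{R}$ and $t\ge t_0$, where $$\zeta^\pm(t)=\zeta_0^\pm\pm\frac{A\epsilon}{\omega}\bigl(1-e^{-\omega(t-t_0)}\bigr)\quad\text{and}\quad q(t)=\epsilon e^{-\omega(t-t_0)} .$$ (2) Let $\beta_0>0$. Suppose $t_0\in\mathbb{R}$ and $u_0\in C^b_{\rm unif}(\mathbb{R},\mathbb{R})$ satisfy $u_0:\mathbb{R}\to[0,1]$,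 $u_0(-\infty)=1$, and there is $C>0$ with $|u_0(x)-u(t_0,x)|\le Ce^{-\beta_0(x-X(t_0))}$ for all $x\in\mathbb{R}$. Then there exist $\omega>0$ and $\tilde\epsilon_0>0$ such that for any $\epsilon\in(0,\tilde\epsilon_0]$ there are $\zeta^\pm=\zeta^\pm(\epsilon,u_0)\in\mathbb{R}$ such that $$u(t,x-\zeta^-)-\epsilon e^{-\omega(t-t_0)}\le u(t,x;t_0,u_0)\le u(t,x-\zeta^+)+\epsilon e^{-\omega(t-t_0)}$$ for all $x\in\mathbb{R}$ and $t\ge t_0$.
   Context: Equation. Consider $u_t=J*u-u+f(t,u)$, $(t,x)\in\mathbb{R}\times\mathbb{R}$, where $[J*u](t,x)=\int_{\mathbb{R}}J(x-y)u(t,y)\,dy$. Assumptions on $J$: $J\not\equiv 0$, $J\in C^1(\mathbb{R})$, $J(x)=J(-x)\ge 0$ for all $x$, $\int_{\mathbb{R}}J(x)dx=1$, $\int_{\mathbb{R}}|J'(x)|dx<\infty$, and $\int_{\mathbb{R}}J(x)e^{\lambda x}dx<\infty$ for all $\lambda>0$. Assumptions on $f$: $f:\mathbb{R}\times[0,\infty)\to\mathbb{R}$ is continuously differentiable and (a) there are $\theta\in(0,1)$, $f_{\min}\in C^{1,\gamma}([0,1])$ (for some Hölder exponent $\gamma$) and a Lipschitz function $f_{\max}:[0,1]\to\mathbb{R}$ with $f_{\min}(w)=f_{\max}(w)=0$ for $w\in[0,\theta]\cup\{1\}$, $0<f_{\min}(w)\le f_{\max}(w)$ for $w\in(\theta,1)$,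 $f_{\min}'(1)<0$, such that $f_{\min}(w)\le f(t,w)\le f_{\max}(w)$ for $(t,w)\in\mathbb{R}\times[0,1]$; (b) $f(t,w)<0$ for $(t,w)\in\mathbb{R}\times(1,\infty)$; (c) $\sup_{\mathbb{R}\times[0,1]}|f_t|<\infty$ and $\sup_{\mathbb{R}\times[0,\infty)}|f_u|<\infty$; (d) there are $\tilde\theta\in(\theta,1)$ and $\tilde\beta>0$ with $f_u(t,w)\le -\tilde\beta$ for all $(t,w)\in\mathbb{R}\times[\tilde\theta,2]$; moreover $f$ is extended by $f(t,w)=0$ for $(t,w)\in\mathbb{R}\times(-\infty,0)$; (e) $f(t,u)$ is twice continuously differentiable in $u$ and $\sup_{\mathbb{R}\times[0,1]}|f_{uu}|<\infty$. Approximating solutions (known facts). There are a unique $c^*_{\min}>0$ and a unique $C^1$ function $\phi_{\min}:\mathbb{R}\to(0,1)$ with $J*\phi_{\min}-\phi_{\min}+c^*_{\min}\phi_{\min}'+f_{\min}(\phi_{\min})=0$, $\phi_{\min}'<0$, $\phi_{\min}(0)=\theta$, $\phi_{\min}(-\infty)=1$, $\phi_{\min}(\infty)=0$. For each $s<0$ there is a unique $y_s\in\mathbb{R}$ (with $y_s\to-\infty$ as $s\to-\infty$) such that the classical solution $u(t,x;s)$, $t\ge s$, of the equation with $u(s,x;s)=\phi_{\min}(x-y_s)$ satisfies $u(0,0;s)=\theta$. Each $u(t,x;s)$ is strictly decreasing in $x$ with $u(t,-\infty;s)=1$, $u(t,\infty;s)=0$; for $\lambda\in(0,1)$ let $X_\lambda(t;s)$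 be the point with $u(t,X_\lambda(t;s);s)=\lambda$. There are positive constants $c_{\min},c_{\max},c_\pm,h_\pm$ (independent of $s$) and twice continuously differentiable functions $X(\cdot;s):[s,\infty)\to\mathbb{R}$ such that, for all $s<0$, $t\ge s$: $c_{\min}\le\dot X(t;s)\le c_{\max}$; $\sup_{s<0,t\ge s}|\ddot X(t;s)|<\infty$; $\sup_{s<0,t\ge s}|X(t;s)-X_\lambda(t;s)|<\infty$ for every $\lambda\in(0,1)$; $u(t,x;s)\ge 1-e^{c_-(x-X(t;s)+h_-)}$ for $x\le X(t;s)-h_-$; $u(t,x;s)\le e^{-c_+(x-X(t;s)-h_+)}$ for $x\ge X(t;s)+h_+$. Moreover $u(t,x;s)$ is Lipschitz in $x$ uniformly in $s<0$, $t\ge s$. The transition front. A transition front is an entire solution $u$ with $u(t,-\infty)=1$, $u(t,\infty)=0$ for all $t$ and $\sup_{t\in\mathbb{R}}\mathrm{diam}\{x:\epsilon\le u(t,x)\le 1-\epsilon\}<\infty$ for every $\epsilon\in(0,1)$. Throughout, $u(t,x)$ is the transition front and $X:\mathbb{R}\to\mathbb{R}$ the continuously differentiable function obtained as limits: $X(t;s)\to X(t)$, $u(t,x;s)\to u(t,x)$, $u_t(t,x;s)\to u_t(t,x)$ locally uniformly in $(t,x)\in\mathbb{R}\times\mathbb{R}$ as $s\to-\infty$ along some subsequence. It is known that $u$ is strictly decreasing in $x$ and Lipschitz in $x$ uniformly in $t$, that $\dot X(t)\in[c_{\min},c_{\max}]$ for all $t\in\mathbb{R}$, and that, for all $t\in\mathbb{R}$,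 $u(t,x)\ge 1-e^{c_-(x-X(t)+h_-)}$ for $x\le X(t)-h_-$ and $u(t,x)\le e^{-c_+(x-X(t)-h_+)}$ for $x\ge X(t)+h_+$. Further notation. $C^b_{\rm unif}(\mathbb{R},\mathbb{R})$ is the space of bounded uniformly continuous functions on $\mathbb{R}$. For $u_0\in C^b_{\rm unif}(\mathbb{R},\mathbb{R})$, $u(t,x;t_0,u_0)$, $t\ge t_0$, is the unique solution of the equation with $u(t_0,\cdot;t_0,u_0)=u_0$. Fix $M_1>0$ such that for every $t\in\mathbb{R}$: $u(t,x)\ge\frac{1+\tilde\theta}{2}$ if $x-X(t)\le -M_1$, and $u(t,x)\le\frac{\theta}{2}$ if $x-X(t)\ge M_1$. For each $\alpha>0$ let $\Gamma_\alpha:\mathbb{R}\to[0,1]$ be a (fixed) smooth nonincreasing function with $\Gamma_\alpha(x)=1$ for $x\le -M_1-1$ and $\Gamma_\alpha(x)=e^{-\alpha(x-M_1)}$ for $x\ge M_1+1$. Here $u_0(-\infty)=\lim_{x\to-\infty}u_0(x)$. *)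

theory Defs
  imports "HOL-Analysis.Analysis"
begin

section \<open>Solutions of the nonlocal equation\<close>

definition conv :: "(real \<Rightarrow> real) \<Rightarrow> (real \<Rightarrow> real) \<Rightarrow> real \<Rightarrow> real" where
  "conv J g x = (\<integral>y. J (x - y) * g y \<partial>lborel)"

text \<open>The space of bounded uniformly continuous real functions on the line.\<close>

definition BUC :: "(real \<Rightarrow> real) set" where
  "BUC = {g. bounded (range g) \<and> uniformly_continuous_on UNIV g}"

text \<open>
  Solutions of \<open>u\<^sub>t = J * u - u + f(t,u)\<close> on a time interval \<open>I\<close>: continuous curves in \<^const>\<open>BUC\<close>
  (supremum norm) along which the equation holds at every point; the time derivative is
  one-sided at an end point of \<open>I\<close>.  Since \<open>J * u - u + f(t,u)\<close> is then a continuous curve in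
  \<^const>\<open>BUC\<close> too, these are exactly the continuously differentiable solutions of the equation
  regarded as an ordinary differential equation in that Banach space.
\<close>

definition solves_on ::
  "(real \<Rightarrow> real) \<Rightarrow> (real \<Rightarrow> real \<Rightarrow> real) \<Rightarrow> real set \<Rightarrow> (real \<Rightarrow> real \<Rightarrow> real) \<Rightarrow> bool" where
  "solves_on J f I u \<longleftrightarrow>
    (\<forall>t\<in>I. u t \<in> BUC \<and> uniform_limit UNIV u (u t) (at t within I) \<and>
      (\<forall>x. ((\<lambda>\<tau>. u \<tau> x) has_real_derivative (conv J (u t) x - u t x + f t (u t x)))
             (at t within I)))"

text \<open>
  \<open>solves_ivp J f t\<^sub>0 u\<^sub>0 v\<close>: the values \<open>v t x\<close> for \<open>t \<ge> t\<^sub>0\<close> are the solution \<open>u(t,x;t\<^sub>0,u\<^sub>0)\<close>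
  (values of \<open>v\<close> at times before \<open>t\<^sub>0\<close> are irrelevant).
\<close>

definition solves_ivp ::
  "(real \<Rightarrow> real) \<Rightarrow> (real \<Rightarrow> real \<Rightarrow> real) \<Rightarrow> real \<Rightarrow> (real \<Rightarrow> real) \<Rightarrow> (real \<Rightarrow> real \<Rightarrow> real) \<Rightarrow> bool" where
  "solves_ivp J f t\<^sub>0 u\<^sub>0 v \<longleftrightarrow> solves_on J f {t\<^sub>0..} v \<and> v t\<^sub>0 = u\<^sub>0"

definition transition_front ::
  "(real \<Rightarrow> real) \<Rightarrow> (real \<Rightarrow> real \<Rightarrow> real) \<Rightarrow> (real \<Rightarrow> real \<Rightarrow> real) \<Rightarrow> bool" where
  "transition_front J f u \<longleftrightarrow>
    solves_on J f UNIV u \<and>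
    (\<forall>t. (u t \<longlongrightarrow> 1) at_bot \<and> (u t \<longlongrightarrow> 0) at_top) \<and>
    (\<forall>\<epsilon>. 0 < \<epsilon> \<and> \<epsilon> < 1 \<longrightarrow>
      (\<exists>B. \<forall>t. bounded {x. \<epsilon> \<le> u t x \<and> u t x \<le> 1 - \<epsilon>} \<and>
               diameter {x. \<epsilon> \<le> u t x \<and> u t x \<le> 1 - \<epsilon>} \<le> B))"

text \<open>\<open>X\<^sub>\<lambda>\<close>: the point where the strictly decreasing profile \<open>g\<close> takes the value \<open>l\<close>.\<close>

definition level_point :: "(real \<Rightarrow> real) \<Rightarrow> real \<Rightarrow> real" where
  "level_point g l = (THE x. g x = l)"

definition smooth :: "(real \<Rightarrow> real) \<Rightarrow> bool" where
  "smooth g \<longleftrightarrow> (\<forall>n x. (deriv ^^ n) g field_differentiable at x)"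


section \<open>Standing assumptions\<close>

locale dispersal_kernel =
  fixes J :: "real \<Rightarrow> real"
  assumes J_nontrivial: "J \<noteq> (\<lambda>x. 0)"
    and J_C1: "J C1_differentiable_on UNIV"
    and J_even: "J x = J (- x)"
    and J_nonneg: "J x \<ge> 0"
    and J_mass: "has_bochner_integral lborel J 1"
    and J_deriv_integrable: "integrable lborel (\<lambda>x. \<bar>deriv J x\<bar>)"
    and J_exp_moments: "l > 0 \<Longrightarrow> integrable lborel (\<lambda>x. J x * exp (l * x))"

text \<open>
  The functions \<open>f\<^sub>t\<close>, \<open>f\<^sub>u\<close>, \<open>f\<^sub>u\<^sub>u\<close> are parameters, but they are determined by \<open>f\<close> on the half plane
  \<open>w \<ge> 0\<close>; at \<open>w = 0\<close> derivatives in \<open>w\<close> are taken from the right, and the derivative \<open>f\<^sub>m\<^sub>i\<^sub>n'\<close> on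
  \<open>[0,1]\<close> is one-sided at both end points.  \<open>\<theta>\<^sub>1\<close> and \<open>\<beta>\<^sub>1\<close> stand for \<open>\<theta>\<close> and \<open>\<beta>\<close> with a tilde.
\<close>

locale ignition_nonlinearity =
  fixes f ft fu fuu :: "real \<Rightarrow> real \<Rightarrow> real"
    and fmin fmin' fmax :: "real \<Rightarrow> real"
    and \<theta> \<theta>\<^sub>1 \<beta>\<^sub>1 :: real
  assumes f_t: "w \<ge> 0 \<Longrightarrow> ((\<lambda>\<tau>. f \<tau> w) has_real_derivative ft t w) (at t)"
    and f_u: "w \<ge> 0 \<Longrightarrow> (f t has_real_derivative fu t w) (at w within {0..})"
    and f_t_cont: "continuous_on (UNIV \<times> {0..}) (\<lambda>(t, w). ft t w)"
    and f_u_cont: "continuous_on (UNIV \<times> {0..}) (\<lambda>(t, w). fu t w)"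
    and \<theta>: "0 < \<theta>" "\<theta> < 1"
    and fmin_deriv: "w \<in> {0..1} \<Longrightarrow> (fmin has_real_derivative fmin' w) (at w within {0..1})"
    and fmin_Hoelder: "\<exists>\<gamma> C. 0 < \<gamma> \<and> \<gamma> \<le> 1 \<and>
          (\<forall>v\<in>{0..1}. \<forall>w\<in>{0..1}. \<bar>fmin' v - fmin' w\<bar> \<le> C * \<bar>v - w\<bar> powr \<gamma>)"
    and fmax_Lipschitz: "\<exists>L. L-lipschitz_on {0..1} fmax"
    and fmin_fmax_zero: "w \<in> {0..\<theta>} \<union> {1} \<Longrightarrow> fmin w = 0 \<and> fmax w = 0"
    and fmin_fmax_pos: "w \<in> {\<theta><..<1} \<Longrightarrow> 0 < fmin w \<and> fmin w \<le> fmax w"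
    and fmin'_1: "fmin' 1 < 0"
    and f_between: "w \<in> {0..1} \<Longrightarrow> fmin w \<le> f t w \<and> f t w \<le> fmax w"
    and f_neg: "w > 1 \<Longrightarrow> f t w < 0"
    and f_t_bounded: "bounded ((\<lambda>(t, w). ft t w) ` (UNIV \<times> {0..1}))"
    and f_u_bounded: "bounded ((\<lambda>(t, w). fu t w) ` (UNIV \<times> {0..}))"
    and \<theta>\<^sub>1: "\<theta> < \<theta>\<^sub>1" "\<theta>\<^sub>1 < 1"
    and \<beta>\<^sub>1: "\<beta>\<^sub>1 > 0"
    and f_u_le: "w \<in> {\<theta>\<^sub>1..2} \<Longrightarrow> fu t w \<le> - \<beta>\<^sub>1"
    and f_extension: "w < 0 \<Longrightarrow> f t w = 0"
    and f_uu: "w \<ge> 0 \<Longrightarrow> (fu t has_real_derivative fuu t w) (at w within {0..})"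
    and f_uu_cont: "continuous_on {0..} (fuu t)"
    and f_uu_bounded: "bounded ((\<lambda>(t, w). fuu t w) ` (UNIV \<times> {0..1}))"


section \<open>The approximating solutions and the transition front\<close>

text \<open>
  \<open>us s t x\<close> and \<open>Xs s t\<close> are \<open>u(t,x;s)\<close> and \<open>X(t;s)\<close>, meaningful for \<open>s < 0\<close> and \<open>t \<ge> s\<close> only;
  \<open>dXs\<close> and \<open>ddXs\<close> are the first two time derivatives of \<open>Xs\<close>.
\<close>

locale approximating_solutions =
  dispersal_kernel J + ignition_nonlinearity f ft fu fuu fmin fmin' fmax \<theta> \<theta>\<^sub>1 \<beta>\<^sub>1
  for J :: "real \<Rightarrow> real"
    and f ft fu fuu :: "real \<Rightarrow> real \<Rightarrow> real"
    and fmin fmin' fmax :: "real \<Rightarrow> real"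
    and \<theta> \<theta>\<^sub>1 \<beta>\<^sub>1 :: real +
  fixes c_star :: real and \<phi> :: "real \<Rightarrow> real" and y :: "real \<Rightarrow> real"
    and us :: "real \<Rightarrow> real \<Rightarrow> real \<Rightarrow> real"
    and Xs dXs ddXs :: "real \<Rightarrow> real \<Rightarrow> real"
    and c_min c_max c_minus c_plus h_minus h_plus :: real
  assumes c_star_pos: "c_star > 0"
    and \<phi>_range: "0 < \<phi> x" "\<phi> x < 1"
    and \<phi>_C1: "\<phi> C1_differentiable_on UNIV"
    and \<phi>_eq: "conv J \<phi> x - \<phi> x + c_star * deriv \<phi> x + fmin (\<phi> x) = 0"
    and \<phi>_deriv_neg: "deriv \<phi> x < 0"
    and \<phi>_0: "\<phi> 0 = \<theta>"
    and \<phi>_limits: "(\<phi> \<longlongrightarrow> 1) at_bot" "(\<phi> \<longlongrightarrow> 0) at_top"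
    and y_limit: "filterlim y at_bot at_bot"
    and us_solves: "s < 0 \<Longrightarrow> solves_ivp J f s (\<lambda>x. \<phi> (x - y s)) (us s)"
    and us_0_0: "s < 0 \<Longrightarrow> us s 0 0 = \<theta>"
    and us_decreasing: "s < 0 \<Longrightarrow> s \<le> t \<Longrightarrow> x < x' \<Longrightarrow> us s t x' < us s t x"
    and us_limits: "s < 0 \<Longrightarrow> s \<le> t \<Longrightarrow> (us s t \<longlongrightarrow> 1) at_bot"
      "s < 0 \<Longrightarrow> s \<le> t \<Longrightarrow> (us s t \<longlongrightarrow> 0) at_top"
    and us_Lipschitz: "\<exists>L. \<forall>s<0. \<forall>t\<ge>s. L-lipschitz_on UNIV (us s t)"
    and constants_pos: "c_min > 0" "c_max > 0" "c_minus > 0" "c_plus > 0" "h_minus > 0" "h_plus > 0"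
    and Xs_deriv: "s < 0 \<Longrightarrow> s \<le> t \<Longrightarrow> (Xs s has_real_derivative dXs s t) (at t within {s..})"
    and Xs_deriv2: "s < 0 \<Longrightarrow> s \<le> t \<Longrightarrow> (dXs s has_real_derivative ddXs s t) (at t within {s..})"
    and Xs_deriv2_cont: "s < 0 \<Longrightarrow> continuous_on {s..} (ddXs s)"
    and Xs_speed: "s < 0 \<Longrightarrow> s \<le> t \<Longrightarrow> c_min \<le> dXs s t \<and> dXs s t \<le> c_max"
    and Xs_deriv2_bounded: "\<exists>B. \<forall>s<0. \<forall>t\<ge>s. \<bar>ddXs s t\<bar> \<le> B"
    and Xs_level: "0 < l \<Longrightarrow> l < 1 \<Longrightarrow> \<exists>B. \<forall>s<0. \<forall>t\<ge>s. \<bar>Xs s t - level_point (us s t) l\<bar> \<le> B"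
    and us_left: "s < 0 \<Longrightarrow> s \<le> t \<Longrightarrow> x \<le> Xs s t - h_minus \<Longrightarrow>
          us s t x \<ge> 1 - exp (c_minus * (x - Xs s t + h_minus))"
    and us_right: "s < 0 \<Longrightarrow> s \<le> t \<Longrightarrow> x \<ge> Xs s t + h_plus \<Longrightarrow>
          us s t x \<le> exp (- c_plus * (x - Xs s t - h_plus))"

text \<open>
  \<open>sn\<close> is the sequence \<open>s \<rightarrow> -\<infinity>\<close> along which the limits are taken.  For \<open>t\<close> in a compact set and
  large \<open>n\<close> one has \<open>sn n < t\<close>, so that the two-sided derivative of \<open>us (sn n) \<cdot> x\<close> at \<open>t\<close> exists.
\<close>

locale limiting_front =
  approximating_solutions J f ft fu fuu fmin fmin' fmax \<theta> \<theta>\<^sub>1 \<beta>\<^sub>1 c_star \<phi> y us Xs dXs ddXs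
    c_min c_max c_minus c_plus h_minus h_plus
  for J :: "real \<Rightarrow> real"
    and f ft fu fuu :: "real \<Rightarrow> real \<Rightarrow> real"
    and fmin fmin' fmax :: "real \<Rightarrow> real"
    and \<theta> \<theta>\<^sub>1 \<beta>\<^sub>1 :: real
    and c_star :: real and \<phi> :: "real \<Rightarrow> real" and y :: "real \<Rightarrow> real"
    and us :: "real \<Rightarrow> real \<Rightarrow> real \<Rightarrow> real"
    and Xs dXs ddXs :: "real \<Rightarrow> real \<Rightarrow> real"
    and c_min c_max c_minus c_plus h_minus h_plus :: real +
  fixes sn :: "nat \<Rightarrow> real" and u :: "real \<Rightarrow> real \<Rightarrow> real" and X :: "real \<Rightarrow> real"
  assumes sn_neg: "sn n < 0"
    and sn_limit: "filterlim sn at_bot sequentially"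
    and X_limit: "compact K \<Longrightarrow> uniform_limit K (\<lambda>n. Xs (sn n)) X sequentially"
    and u_limit: "compact Q \<Longrightarrow>
          uniform_limit Q (\<lambda>n (t, x). us (sn n) t x) (\<lambda>(t, x). u t x) sequentially"
    and u_t_limit: "compact Q \<Longrightarrow>
          uniform_limit Q (\<lambda>n (t, x). deriv (\<lambda>\<tau>. us (sn n) \<tau> x) t)
            (\<lambda>(t, x). deriv (\<lambda>\<tau>. u \<tau> x) t) sequentially"
    and u_front: "transition_front J f u"
    and u_decreasing: "x < x' \<Longrightarrow> u t x' < u t x"
    and u_Lipschitz: "\<exists>L. \<forall>t. L-lipschitz_on UNIV (u t)"
    and X_C1: "X C1_differentiable_on UNIV"
    and X_speed: "deriv X t \<in> {c_min..c_max}"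
    and u_left: "x \<le> X t - h_minus \<Longrightarrow> u t x \<ge> 1 - exp (c_minus * (x - X t + h_minus))"
    and u_right: "x \<ge> X t + h_plus \<Longrightarrow> u t x \<le> exp (- c_plus * (x - X t - h_plus))"

text \<open>\<open>M\<^sub>1\<close> and the family of weights \<open>\<Gamma> \<alpha>\<close>, \<open>\<alpha> > 0\<close>, attached to the front.\<close>

definition cutoff_width ::
  "(real \<Rightarrow> real \<Rightarrow> real) \<Rightarrow> (real \<Rightarrow> real) \<Rightarrow> real \<Rightarrow> real \<Rightarrow> real \<Rightarrow> bool" where
  "cutoff_width u X \<theta> \<theta>\<^sub>1 M\<^sub>1 \<longleftrightarrow> M\<^sub>1 > 0 \<and>
    (\<forall>t x. (x - X t \<le> - M\<^sub>1 \<longrightarrow> u t x \<ge> (1 + \<theta>\<^sub>1) / 2) \<and>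
           (x - X t \<ge> M\<^sub>1 \<longrightarrow> u t x \<le> \<theta> / 2))"

definition weight_family :: "real \<Rightarrow> (real \<Rightarrow> real \<Rightarrow> real) \<Rightarrow> bool" where
  "weight_family M\<^sub>1 \<Gamma> \<longleftrightarrow> (\<forall>\<alpha>>0.
    range (\<Gamma> \<alpha>) \<subseteq> {0..1} \<and> smooth (\<Gamma> \<alpha>) \<and> antimono (\<Gamma> \<alpha>) \<and>
    (\<forall>x \<le> - M\<^sub>1 - 1. \<Gamma> \<alpha> x = 1) \<and>
    (\<forall>x \<ge> M\<^sub>1 + 1. \<Gamma> \<alpha> x = exp (- \<alpha> * (x - M\<^sub>1))))"

end

theory Submission
  imports Defs
begin

text \<open>
  The stability estimates come from a comparison argument: shifting the front by
  \<open>\<zeta>(t)\<close> and adding the weight \<open>q(t) \<Gamma>\<close> produces a super- or a subsolution,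
  provided that the shift moves fast enough.  Write \<open>z = x - \<zeta>(t) - X(t)\<close>.  Three mechanisms make this work.

  \<^item> Behind the front (\<open>z\<close> very negative) the reaction is decreasing with slope at most \<open>-\<beta>\<^sub>1\<close>, so that a
    perturbation decays at rate \<open>\<beta>\<^sub>1\<close>.

  \<^item> Ahead of the front (\<open>z\<close> very positive) the reaction vanishes.  There the weight is
    \<open>exp (-\<alpha>(z - M\<^sub>1))\<close>; it is carried along with speed at least \<open>c_min\<close>, a gain of first order in \<open>\<alpha>\<close>,
    whereas dispersal by the even kernel \<open>J\<close> amplifies it by \<open>\<integral>J(w) exp (\<alpha> w) dw - 1\<close> only, which is
    of second order in \<open>\<alpha>\<close>.  Hence small \<open>\<alpha>\<close> gives decay.

  \<^item> In the bounded interface between the two regions all error terms are at most a constant times \<open>q\<close>,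
    and they are absorbed by the motion of the shift, \<open>\<zeta>' = \<plusminus> A q\<close>, because the front is uniformly
    steep there: \<open>u(t,x) - u(t,x+h) \<ge> \<delta> h\<close> (lemma \<open>steepness\<close>).

  Steepness is proved without differentiating \<open>u\<close> in \<open>x\<close>.  The difference \<open>w(t,x) = u(t,x) - u(t,x+h)\<close> is
  nonnegative and satisfies \<open>w\<^sub>t \<ge> J * w - (1 + K) w\<close>, where \<open>K\<close> is a Lipschitz constant of \<open>f\<close>.  Since \<open>u\<close> drops
  by at least \<open>1/2\<close> across the interface, \<open>w\<close> has mass of order \<open>h\<close> there one time unit earlier, and
  finitely many convolutions with \<open>J\<close> spread this mass over any prescribed neighbourhood of \<open>X(t)\<close>.

  As \<open>u(t, x - \<zeta>(t))\<close> need not be differentiable in \<open>t\<close>, the comparison principle is formulated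
  with left lower Dini derivatives in time (lemma \<open>comparison\<close>).  The second assertion then follows from the first one
  for a small \<open>\<alpha>\<close>, because a sufficiently large shift to either side puts the initial datum between
  two perturbed fronts.
\<close>

section \<open>Comparison through left Dini derivatives\<close>

text \<open>
  A mean value inequality for continuous functions: with an extra slope \<open>e > 0\<close> the set of points from which the
  bound holds up to \<open>b\<close> is closed, and the Dini condition lets its minimum move to the left until it reaches \<open>a\<close>.
\<close>

lemma left_dini_lower_bound:
  fixes g :: "real \<Rightarrow> real"
  assumes ab: "a \<le> b" and cont: "continuous_on {a..b} g"
    and dini: "\<And>t e. a < t \<Longrightarrow> t \<le> b \<Longrightarrow> e > 0 \<Longrightarrow>
      \<forall>\<^sub>F \<tau> in at_left t. g t - g \<tau> \<ge> - (C + e) * (t - \<tau>)"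
  shows "g b - g a \<ge> - C * (b - a)"
proof -
  have *: "g b - g a \<ge> - (C + e) * (b - a)" if e: "e > 0" for e
  proof -
    define k where "k = (\<lambda>\<tau>. g \<tau> + (C + e) * \<tau>)"
    \<comment> \<open>In terms of \<open>k\<close> the claim with slack \<open>e\<close> reads \<open>k a \<le> k b\<close>.\<close>
    define S where "S = {\<tau> \<in> {a..b}. k \<tau> \<le> k b}"
    have ck: "continuous_on {a..b} k"
      unfolding k_def by (intro continuous_intros cont)
    have S_eq: "S = {a..b} \<inter> k -` {..k b}" by (auto simp: S_def)
    have "closed S"
      unfolding S_eq by (rule continuous_closed_preimage[OF ck closed_atLeastAtMost closed_atMost])
    moreover have "bounded S" by (rule bounded_subset[of "{a..b}"]) (auto simp: S_def)
    ultimately have "compact S" by (simp add: compact_eq_bounded_closed)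
    moreover have "S \<noteq> {}" using ab by (auto simp: S_def)
    ultimately have "\<exists>m\<in>S. \<forall>\<tau>\<in>S. m \<le> \<tau>" by (rule compact_attains_inf)
    then obtain m where m: "m \<in> S" "\<And>\<tau>. \<tau> \<in> S \<Longrightarrow> m \<le> \<tau>" by blast
    have "m = a"
    proof (rule ccontr)
      assume "m \<noteq> a"
      then have am: "a < m" "m \<le> b" using m(1) by (auto simp: S_def)
      have "\<forall>\<^sub>F \<tau> in at_left m. g m - g \<tau> \<ge> - (C + e) * (m - \<tau>) \<and> \<tau> \<in> {a<..<m}"
        by (rule eventually_conj[OF dini[OF am e] eventually_at_left_real[OF am(1)]])
      then have "\<exists>\<tau>. g m - g \<tau> \<ge> - (C + e) * (m - \<tau>) \<and> \<tau> \<in> {a<..<m}"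
        by (rule eventually_happens'[OF trivial_limit_at_left_real])
      then obtain \<tau> where t: "g m - g \<tau> \<ge> - (C + e) * (m - \<tau>)" "\<tau> \<in> {a<..<m}" by blast
      have "k \<tau> \<le> k m" using t(1) by (simp add: k_def algebra_simps)
      then have "\<tau> \<in> S" using m(1) t(2) by (auto simp: S_def)
      then show False using m(2)[of \<tau>] t(2) by auto
    qed
    then have "k a \<le> k b" using m(1) by (simp add: S_def)
    then show ?thesis by (simp add: k_def algebra_simps)
  qed
  have "((\<lambda>e. - (C + e) * (b - a)) \<longlongrightarrow> - (C + 0) * (b - a)) (at_right 0)"
    by (intro tendsto_intros)
  moreover have "\<forall>\<^sub>F e in at_right 0. - (C + e) * (b - a) \<le> g b - g a"
    by (rule eventually_at_right_less[THEN eventually_mono]) (use * in auto)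
  ultimately have "- (C + 0) * (b - a) \<le> g b - g a"
    by (rule tendsto_upperbound) simp
  then show ?thesis by simp
qed

text \<open>
  The infimum of \<open>D t\<close> over the line need not be attained, so a first zero is not available.  Instead
  any lower bound \<open>- S\<close> on the strip is improved to \<open>- S / 2\<close>: a negative value \<open>D t x\<close> can only have built up since
  the last time at which \<open>D\<close> was nonnegative at \<open>x\<close>, at rate at most \<open>C S\<close> and during a time at most \<open>1/(2 C)\<close>.
  The nonlocal term is hidden in the hypothesis, where
  the rate at \<open>x\<close> depends on a lower bound of \<open>D t\<close> on the whole line.
\<close>

lemma comparison_short_time:
  fixes D :: "real \<Rightarrow> real \<Rightarrow> real"
  assumes short: "C \<ge> 0" "C * (b - a) \<le> 1/2"
    and cont: "\<And>x. continuous_on {a..b} (\<lambda>t. D t x)"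
    and bound: "\<And>t x. t \<in> {a..b} \<Longrightarrow> D t x \<ge> - S"
    and init: "\<And>x. D a x \<ge> 0"
    and dini: "\<And>t x S e. a < t \<Longrightarrow> t \<le> b \<Longrightarrow> D t x < 0 \<Longrightarrow> (\<And>y. D t y \<ge> - S) \<Longrightarrow> e > 0 \<Longrightarrow>
      \<forall>\<^sub>F \<tau> in at_left t. D t x - D \<tau> x \<ge> - (C * S + e) * (t - \<tau>)"
    and t: "t \<in> {a..b}"
  shows "D t x \<ge> 0"
proof -
  have half: "D t x \<ge> - (S / 2)" if S: "S \<ge> 0" "\<And>t x. t \<in> {a..b} \<Longrightarrow> D t x \<ge> - S"
    and t: "t \<in> {a..b}" for S t x
  proof (cases "D t x < 0")
    case True
    \<comment> \<open>The maximum of \<open>Z\<close> is the last time before \<open>t\<close> at which \<open>D\<close> is nonnegative at \<open>x\<close>.\<close>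
    define Z where "Z = {s \<in> {a..t}. D s x \<ge> 0}"
    have ct: "continuous_on {a..t} (\<lambda>t. D t x)"
      using cont by (rule continuous_on_subset) (use t in auto)
    have Z_eq: "Z = {a..t} \<inter> (\<lambda>t. D t x) -` {0..}" by (auto simp: Z_def)
    have "closed Z"
      unfolding Z_eq by (rule continuous_closed_preimage[OF ct closed_atLeastAtMost closed_atLeast])
    moreover have "bounded Z" by (rule bounded_subset[of "{a..t}"]) (auto simp: Z_def)
    ultimately have "compact Z" by (simp add: compact_eq_bounded_closed)
    moreover have "Z \<noteq> {}" using t init by (auto simp: Z_def)
    ultimately have "\<exists>r\<in>Z. \<forall>s\<in>Z. s \<le> r" by (rule compact_attains_sup)
    then obtain r where r: "r \<in> Z" "\<And>s. s \<in> Z \<Longrightarrow> s \<le> r" by blast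
    have rt: "a \<le> r" "r \<le> t" "D r x \<ge> 0" using r(1) by (auto simp: Z_def)
    have neg: "D s x < 0" if "r < s" "s \<le> t" for s
      using r(2)[of s] that rt by (force simp: Z_def)
    have "D t x - D r x \<ge> - (C * S) * (t - r)"
    proof (rule left_dini_lower_bound[OF rt(2)])
      show "continuous_on {r..t} (\<lambda>t. D t x)"
        using ct by (rule continuous_on_subset) (use rt in auto)
      fix s e :: real assume s: "r < s" "s \<le> t" "e > 0"
      show "\<forall>\<^sub>F \<tau> in at_left s. D s x - D \<tau> x \<ge> - (C * S + e) * (s - \<tau>)"
        by (rule dini) (use s rt t neg S(2) in simp_all)
    qed
    moreover have "C * S * (t - r) \<le> C * S * (b - a)"
      by (rule mult_left_mono) (use short S(1) rt t in auto)
    moreover have "C * (b - a) * S \<le> 1/2 * S"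
      by (rule mult_right_mono) (use short S(1) in auto)
    ultimately show ?thesis using rt(3) by (simp add: algebra_simps)
  qed (use S(1) in simp)
  define S0 where "S0 = max S 0"
  have iter: "\<forall>t\<in>{a..b}. \<forall>x. D t x \<ge> - (S0 / 2 ^ n)" for n
  proof (induction n)
    case 0
    show ?case
    proof (intro ballI allI)
      fix t x assume "t \<in> {a..b}"
      then show "- (S0 / 2 ^ 0) \<le> D t x" using bound[of t x] by (simp add: S0_def)
    qed
  next
    case (Suc n)
    show ?case
    proof (intro ballI allI)
      fix t x assume "t \<in> {a..b}"
      then have "D t x \<ge> - (S0 / 2 ^ n / 2)"
        by (intro half) (use Suc in \<open>auto simp: S0_def\<close>)
      then show "- (S0 / 2 ^ Suc n) \<le> D t x" by simp
    qed
  qed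
  have "(\<lambda>n. - (S0 * (1/2) ^ n)) \<longlonglongrightarrow> - (S0 * 0)"
    by (intro tendsto_intros LIMSEQ_power_zero) simp
  then have "- (S0 * 0) \<le> D t x"
    by (rule LIMSEQ_le_const2) (use iter t in \<open>auto simp: power_one_over field_simps\<close>)
  then show ?thesis by simp
qed

lemma comparison:
  fixes D :: "real \<Rightarrow> real \<Rightarrow> real"
  assumes C: "C > 0"
    and cont: "\<And>x. continuous_on {a..b} (\<lambda>t. D t x)"
    and bound: "\<And>t x. t \<in> {a..b} \<Longrightarrow> D t x \<ge> - S"
    and init: "\<And>x. D a x \<ge> 0"
    and dini: "\<And>t x S e. a < t \<Longrightarrow> t \<le> b \<Longrightarrow> D t x < 0 \<Longrightarrow> (\<And>y. D t y \<ge> - S) \<Longrightarrow> e > 0 \<Longrightarrow>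
      \<forall>\<^sub>F \<tau> in at_left t. D t x - D \<tau> x \<ge> - (C * S + e) * (t - \<tau>)"
    and t: "t \<in> {a..b}"
  shows "D t x \<ge> 0"
proof -
  define T where "T = 1 / (2 * C)"
  have T: "T > 0" "C * T = 1/2" using C by (auto simp: T_def)
  have steps: "\<forall>t\<in>{a..b}. t \<le> a + real n * T \<longrightarrow> (\<forall>x. D t x \<ge> 0)" for n
  proof (induction n)
    case 0
    then show ?case using init by auto
  next
    case (Suc n)
    show ?case
    proof (intro ballI impI allI)
      fix t x assume t: "t \<in> {a..b}" "t \<le> a + real (Suc n) * T"
      show "D t x \<ge> 0"
      proof (cases "t \<le> a + real n * T")
        case True then show ?thesis using Suc t by auto
      next
        case False
        define a' where "a' = a + real n * T"
        have a': "a \<le> a'" "a' \<le> t" using False T by (auto simp: a'_def)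
        have "C * (t - a') \<le> 1/2"
          unfolding T(2)[symmetric]
          by (rule mult_left_mono) (use t C in \<open>auto simp: a'_def algebra_simps\<close>)
        show ?thesis
        proof (rule comparison_short_time[of C t a' D S t])
          show "continuous_on {a'..t} (\<lambda>t. D t x)" for x
            using cont by (rule continuous_on_subset) (use a' t in auto)
          show "D a' x \<ge> 0" for x
            using Suc a' t by (auto simp: a'_def)
          show "D s x \<ge> - S" if "s \<in> {a'..t}" for s x
            by (rule bound) (use that a' t in auto)
          show "\<forall>\<^sub>F \<tau> in at_left s. D s x - D \<tau> x \<ge> - (C * S + e) * (s - \<tau>)"
            if "a' < s" "s \<le> t" "D s x < 0" "\<And>y. D s y \<ge> - S" "e > 0" for s x S e
            by (rule dini) (use that a' t in simp_all)
        qed (use C \<open>C * (t - a') \<le> 1/2\<close> a' in simp_all)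
      qed
    qed
  qed
  obtain n where "(t - a) / T \<le> real n" using real_arch_simple by blast
  then have "t \<le> a + real n * T" using T by (simp add: field_simps)
  then show ?thesis using steps t by blast
qed

section \<open>Convolution with the dispersal kernel\<close>

definition BC :: "(real \<Rightarrow> real) set" where
  "BC = {g. continuous_on UNIV g \<and> bounded (range g)}"

lemma BUC_imp_BC: "g \<in> BUC \<Longrightarrow> g \<in> BC"
  by (auto simp: BUC_def BC_def uniformly_continuous_imp_continuous)

lemma BC_I: "continuous_on UNIV g \<Longrightarrow> (\<And>y. \<bar>g y\<bar> \<le> B) \<Longrightarrow> g \<in> BC"
  by (auto simp: BC_def bounded_iff)

lemma BC_D: assumes "g \<in> BC" shows "\<exists>B. continuous_on UNIV g \<and> (\<forall>y. \<bar>g y\<bar> \<le> B)"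
  using assms by (auto simp: BC_def bounded_iff)

lemma BC_const: "(\<lambda>_. k) \<in> BC"
  by (rule BC_I[of _ "\<bar>k\<bar>"]) auto

lemma BC_cmult: assumes "g \<in> BC" shows "(\<lambda>y. k * g y) \<in> BC"
proof -
  obtain B where B: "continuous_on UNIV g" "\<And>y. \<bar>g y\<bar> \<le> B" using BC_D[OF assms] by blast
  show ?thesis
    by (rule BC_I[of _ "\<bar>k\<bar> * B"]) (auto intro!: continuous_intros B mult_left_mono simp: abs_mult)
qed

lemma BC_add: assumes "g \<in> BC" "h \<in> BC" shows "(\<lambda>y. g y + h y) \<in> BC"
  using assms by (auto simp: BC_def intro!: continuous_intros bounded_plus_comp)

lemma BC_diff: assumes "g \<in> BC" "h \<in> BC" shows "(\<lambda>y. g y - h y) \<in> BC"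
  using BC_add[OF assms(1) BC_cmult[OF assms(2), of "-1"]] by simp

lemma BC_shift: assumes "g \<in> BC" shows "(\<lambda>y. g (y + k)) \<in> BC"
proof -
  obtain B where B: "continuous_on UNIV g" "\<And>y. \<bar>g y\<bar> \<le> B" using BC_D[OF assms] by blast
  show ?thesis
    by (rule BC_I[of _ B]) (auto intro!: continuous_on_compose2[OF B(1)] continuous_intros B)
qed

lemma BC_mirror: assumes "g \<in> BC" shows "(\<lambda>y. g (k - y)) \<in> BC"
proof -
  obtain B where B: "continuous_on UNIV g" "\<And>y. \<bar>g y\<bar> \<le> B" using BC_D[OF assms] by blast
  show ?thesis
    by (rule BC_I[of _ B]) (auto intro!: continuous_on_compose2[OF B(1)] continuous_intros B)
qed

context dispersal_kernel begin

lemma J_integrable: "integrable lborel J" and J_integral: "integral\<^sup>L lborel J = 1"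
  using J_mass by (auto simp: has_bochner_integral_iff)

lemma J_continuous: "continuous_on UNIV J"
  using J_C1 C1_differentiable_imp_continuous_on by blast

lemma conv_integrable:
  assumes "g \<in> BC" shows "integrable lborel (\<lambda>w. J w * g (x - w))"
proof -
  obtain B where B: "continuous_on UNIV (\<lambda>w. g (x - w))" "\<And>y. \<bar>g (x - y)\<bar> \<le> B"
    using BC_D[OF BC_mirror[OF assms, of x]] by blast
  have [measurable]: "(\<lambda>w. g (x - w)) \<in> borel_measurable borel" "J \<in> borel_measurable borel"
    using B(1) J_continuous by (auto intro: borel_measurable_continuous_onI)
  show ?thesis
  proof (rule Bochner_Integration.integrable_bound[of lborel "\<lambda>w. B * J w"])
    show "AE w in lborel. norm (J w * g (x - w)) \<le> norm (B * J w)"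
    proof (rule AE_I2)
      fix w
      have "\<bar>g (x - w)\<bar> * J w \<le> \<bar>B\<bar> * J w"
        by (rule mult_right_mono) (use B(2)[of w] J_nonneg in auto)
      then show "norm (J w * g (x - w)) \<le> norm (B * J w)"
        using J_nonneg by (simp add: abs_mult mult.commute)
    qed
  qed (use J_integrable in auto)
qed

lemma conv_eq: "conv J g x = (\<integral>w. J w * g (x - w) \<partial>lborel)"
  unfolding conv_def
  by (subst lborel_integral_real_affine[where c = "-1" and t = x]) auto

lemma conv_mono:
  assumes "g \<in> BC" "h \<in> BC" "\<And>y. g y \<le> h y" shows "conv J g x \<le> conv J h x"
  unfolding conv_eq
  by (intro integral_mono conv_integrable assms mult_left_mono J_nonneg)

lemma conv_const: "conv J (\<lambda>_. k) x = k"
  by (simp add: conv_eq J_integral)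

lemma conv_cmult: "conv J (\<lambda>y. k * g y) x = k * conv J g x"
  unfolding conv_eq by (simp add: mult.left_commute)

lemma conv_add:
  assumes "g \<in> BC" "h \<in> BC" shows "conv J (\<lambda>y. g y + h y) x = conv J g x + conv J h x"
  unfolding conv_eq by (simp add: distrib_left Bochner_Integration.integral_add conv_integrable assms)

lemma conv_diff:
  assumes "g \<in> BC" "h \<in> BC" shows "conv J (\<lambda>y. g y - h y) x = conv J g x - conv J h x"
  unfolding conv_eq by (simp add: right_diff_distrib Bochner_Integration.integral_diff conv_integrable assms)

lemma conv_shift: "conv J (\<lambda>y. g (y + k)) x = conv J g (x + k)"
  unfolding conv_eq by (simp add: algebra_simps)

lemma J_lower_bound:
  obtains p r c where "r > 0" "c > 0" "\<And>w. \<bar>w - p\<bar> \<le> r \<Longrightarrow> J w \<ge> c"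
proof -
  obtain p where "J p \<noteq> 0" using J_nontrivial by auto
  then have p: "J p > 0" using J_nonneg[of p] by auto
  have "isCont J p" using J_continuous by (simp add: continuous_on_eq_continuous_at)
  then obtain d where d: "d > 0" "\<And>w. dist w p < d \<Longrightarrow> dist (J w) (J p) < J p / 2"
    using p unfolding continuous_at_eps_delta by (metis half_gt_zero)
  show thesis
  proof (rule that[of "d / 2" "J p / 2" p])
    fix w assume "\<bar>w - p\<bar> \<le> d / 2"
    then have "dist (J w) (J p) < J p / 2" using d(1) by (intro d(2)) (auto simp: dist_real_def)
    then show "J w \<ge> J p / 2" by (simp add: dist_real_def abs_if split: if_splits)
  qed (use p d in auto)
qed

text \<open>
  Keeping only the part of the convolution where the kernel is bounded below turns mass of \<open>g\<close> on an interval
  into a pointwise bound for \<open>J * g\<close>.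
\<close>

lemma conv_lower_integral:
  assumes g: "g \<in> BC" "\<And>y. g y \<ge> 0"
    and c: "c \<ge> 0" "\<And>y. y \<in> {l..m} \<Longrightarrow> J (x - y) \<ge> c"
  shows "conv J g x \<ge> c * integral {l..m} g"
proof -
  obtain B where B: "continuous_on UNIV g" "\<And>y. \<bar>g y\<bar> \<le> B" using BC_D[OF g(1)] by blast
  have si: "set_integrable lborel {l..m} g"
    by (rule borel_integrable_atLeastAtMost') (rule continuous_on_subset[OF B(1)], simp)
  have "c * integral {l..m} g = (\<integral>y. c * (indicator {l..m} y * g y) \<partial>lborel)"
    using set_borel_integral_eq_integral(2)[OF si] by (simp add: set_lebesgue_integral_def)
  also have "\<dots> \<le> conv J g x"
    unfolding conv_def
  proof (rule integral_mono)
    show "integrable lborel (\<lambda>y. c * (indicator {l..m} y * g y))"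
      using si by (simp add: set_integrable_def)
    show "integrable lborel (\<lambda>y. J (x - y) * g y)"
      using lborel_integrable_real_affine[OF conv_integrable[OF g(1), of x], of "-1" x] by simp
    fix y
    show "c * (indicator {l..m} y * g y) \<le> J (x - y) * g y"
      using c(2)[of y] g(2)[of y] J_nonneg[of "x - y"]
      by (cases "y \<in> {l..m}") (auto intro: mult_right_mono)
  qed
  finally show ?thesis .
qed

end

section \<open>Spreading of positivity\<close>

lemma integral_ge_const_times_length:
  fixes g :: "real \<Rightarrow> real"
  assumes "continuous_on {a..b} g" "\<And>y. y \<in> {a..b} \<Longrightarrow> m \<le> g y" "a \<le> b"
  shows "m * (b - a) \<le> integral {a..b} g"
proof -
  have "integral {a..b} (\<lambda>_. m) \<le> integral {a..b} g"
    by (intro integral_le integrable_continuous_real assms continuous_intros)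
  then show ?thesis using assms(3) by (simp add: mult.commute)
qed

text \<open>
  Shifting the second term cancels the common part of the two integrals and leaves strips of width \<open>h\<close> at the two ends.
  The bound is linear in \<open>h\<close>, which is what turns a drop of \<open>g\<close> into a slope.
\<close>

lemma integral_difference_antimono:
  fixes g :: "real \<Rightarrow> real"
  assumes g: "continuous_on UNIV g" "antimono g" and h: "0 \<le> h" "h \<le> r"
  shows "h * (g (z + h) - g (z + r)) \<le> integral {z..z+r} (\<lambda>y. g y - g (y + h))"
proof -
  have cont: "continuous_on A g" for A using g(1) continuous_on_subset by blast
  have int: "g integrable_on {a..b}" for a b
    by (intro integrable_continuous_real cont)
  have shifted: "continuous_on {z..z+r} (\<lambda>y. g (y + h))"
    by (intro continuous_on_compose2[OF g(1)] continuous_intros) auto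
  have "integral {z..z+r} (\<lambda>y. g y - g (y + h))
      = integral {z..z+r} g - integral {z..z+r} (\<lambda>y. g (y + h))"
    by (intro integral_diff int integrable_continuous_real shifted)
  also have "integral {z..z+r} (\<lambda>y. g (y + h)) = integral {z+h..z+r+h} g"
    using integral_shift_Icc_real[of z "z + r" g h] by (simp add: o_def add.commute)
  also have "\<dots> = integral {z+h..z+r} g + integral {z+r..z+r+h} g"
    by (rule Henstock_Kurzweil_Integration.integral_combine[symmetric]) (use h int in auto)
  also have "integral {z..z+r} g = integral {z..z+h} g + integral {z+h..z+r} g"
    by (rule Henstock_Kurzweil_Integration.integral_combine[symmetric]) (use h int in auto)
  finally have eq: "integral {z..z+r} (\<lambda>y. g y - g (y + h))
      = integral {z..z+h} g - integral {z+r..z+r+h} g" by simp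
  have "g (z + h) * (z + h - z) \<le> integral {z..z+h} g"
    by (rule integral_ge_const_times_length) (use h cont g(2) in \<open>auto dest: antimonoD\<close>)
  moreover have "- g (z + r) * (z + r + h - (z + r)) \<le> integral {z+r..z+r+h} (\<lambda>y. - g y)"
    by (rule integral_ge_const_times_length)
       (use h cont g(2) in \<open>auto dest: antimonoD intro!: continuous_intros\<close>)
  ultimately show ?thesis unfolding eq by (simp add: algebra_simps)
qed

context dispersal_kernel begin

text \<open>
  The interval on which \<open>g \<ge> m\<close> is moved by \<open>p\<close> and widened by \<open>r/2\<close> on both sides: for \<open>x\<close> in the new interval,
  \<open>{x - p - r..x - p + r}\<close> still overlaps the old one in length at least \<open>r/2\<close>.
\<close>

lemma conv_spread:
  assumes J_low: "\<And>w. \<bar>w - p\<bar> \<le> r \<Longrightarrow> J w \<ge> c" and rc: "r > 0" "c \<ge> 0"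
    and g: "g \<in> BC" "\<And>y. g y \<ge> 0" and m: "m \<ge> 0" "\<And>y. y \<in> {z1..z2} \<Longrightarrow> g y \<ge> m"
    and z: "z1 + r \<le> z2" and x: "x \<in> {z1 + p - r/2..z2 + p + r/2}"
  shows "conv J g x \<ge> c * r / 2 * m"
proof -
  define l where "l = max z1 (x - p - r)"
  have l: "z1 \<le> l" "l + r/2 \<le> z2" "x - p - r \<le> l" "l + r/2 \<le> x - p + r"
    using z x rc by (auto simp: l_def max_def)
  have "continuous_on {l..l+r/2} g"
    using g(1) by (auto simp: BC_def intro: continuous_on_subset)
  then have "m * (l + r/2 - l) \<le> integral {l..l+r/2} g"
    by (rule integral_ge_const_times_length) (use m(2) l rc in auto)
  then have "c * (m * (r/2)) \<le> c * integral {l..l+r/2} g"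
    using rc by (intro mult_left_mono) auto
  also have "\<dots> \<le> conv J g x"
    by (rule conv_lower_integral[OF g rc(2)]) (use l in \<open>auto intro!: J_low simp: abs_le_iff\<close>)
  finally show ?thesis by (simp add: algebra_simps)
qed

text \<open>
  Two steps of length \<open>\<tau>\<close>, one with the bump of \<open>J\<close> at \<open>p\<close> and one with its mirror image at \<open>- p\<close>, bring the
  interval back to its place and widen it by \<open>r\<close> on both sides.  The step \<open>\<tau>\<close> is free, so an
  arbitrarily large neighbourhood is reached within a fixed total time; this matters because
  the front moves meanwhile.
\<close>

lemma positivity_spreads:
  fixes W :: "real \<Rightarrow> real \<Rightarrow> real"
  assumes J_low: "\<And>w. \<bar>w - p\<bar> \<le> r \<Longrightarrow> J w \<ge> c" and rc: "r > 0" "c \<ge> 0"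
    and W: "\<And>t. W t \<in> BC" "\<And>t y. W t y \<ge> 0"
    and growth: "\<And>t t' x. t \<le> t' \<Longrightarrow> W t' x \<ge> (t' - t) * conv J (W t) x"
    and d: "d \<ge> 0" "integral {z..z+r} (W s) \<ge> d" and \<tau>: "\<tau> \<ge> 0"
  shows "x \<in> {z - real n * r..z + r + real n * r} \<Longrightarrow>
    W (s + 2 * real (Suc n) * \<tau>) x \<ge> \<tau> * c * d * (\<tau> * (c * r / 2)) ^ (2 * n + 1)"
proof (induction n arbitrary: x)
  case 0
  have J_low': "J w \<ge> c" if "\<bar>w - (- p)\<bar> \<le> r" for w
    using J_low[of "- w"] J_even[of w] that by simp
  \<comment> \<open>The first step converts mass on an interval into a pointwise bound on an interval of length \<open>r\<close>.\<close>
  have first: "W (s + \<tau>) y \<ge> \<tau> * c * d" if "y \<in> {z+p..z+p+r}" for y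
  proof -
    have "c * d \<le> c * integral {z..z+r} (W s)" by (rule mult_left_mono) (use d rc in auto)
    also have "\<dots> \<le> conv J (W s) y"
      by (rule conv_lower_integral[OF W rc(2)]) (use that in \<open>auto intro!: J_low simp: abs_le_iff\<close>)
    finally have "\<tau> * (c * d) \<le> \<tau> * conv J (W s) y" by (rule mult_left_mono) (rule \<tau>)
    then show ?thesis using growth[of s "s + \<tau>" y] \<tau> by (simp add: mult.assoc)
  qed
  have "c * r / 2 * (\<tau> * c * d) \<le> conv J (W (s + \<tau>)) x"
    by (rule conv_spread[OF J_low' rc W, where p = "- p" and m = "\<tau> * c * d" and ?z1.0 = "z + p" and ?z2.0 = "z + p + r"])
       (use first 0 rc d \<tau> in auto)
  then have "\<tau> * (c * r / 2 * (\<tau> * c * d)) \<le> \<tau> * conv J (W (s + \<tau>)) x"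
    by (rule mult_left_mono) (rule \<tau>)
  then show ?case using growth[of "s + \<tau>" "s + 2 * \<tau>" x] \<tau> by (simp add: algebra_simps)
next
  case (Suc n)
  define m where "m = \<tau> * c * d * (\<tau> * (c * r / 2)) ^ (2 * n + 1)"
  define t where "t = s + 2 * real (Suc n) * \<tau>"
  have J_low': "J w \<ge> c" if "\<bar>w - (- p)\<bar> \<le> r" for w
    using J_low[of "- w"] J_even[of w] that by simp
  have m: "m \<ge> 0" unfolding m_def using rc d \<tau> by simp
  have first: "W (t + \<tau>) y \<ge> \<tau> * (c * r / 2) * m"
    if "y \<in> {z - real n * r + p - r/2..z + r + real n * r + p + r/2}" for y
  proof -
    have "c * r / 2 * m \<le> conv J (W t) y"
      by (rule conv_spread[OF J_low rc W m _ _ that])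
         (use Suc.IH rc in \<open>auto simp: m_def t_def\<close>)
    then have "\<tau> * (c * r / 2 * m) \<le> \<tau> * conv J (W t) y" by (rule mult_left_mono) (rule \<tau>)
    then show ?thesis using growth[of t "t + \<tau>" y] \<tau> by (simp add: mult.assoc)
  qed
  have "c * r / 2 * (\<tau> * (c * r / 2) * m) \<le> conv J (W (t + \<tau>)) x"
    by (rule conv_spread[OF J_low' rc W, where p = "- p"
          and ?z1.0 = "z - real n * r + p - r/2" and ?z2.0 = "z + r + real n * r + p + r/2"])
       (use Suc.prems rc m \<tau> first in \<open>auto simp: algebra_simps\<close>)
  then have "\<tau> * (c * r / 2 * (\<tau> * (c * r / 2) * m)) \<le> \<tau> * conv J (W (t + \<tau>)) x"
    by (rule mult_left_mono) (rule \<tau>)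
  also have "\<dots> \<le> W (t + 2 * \<tau>) x"
    using growth[of "t + \<tau>" "t + 2 * \<tau>" x] \<tau> by simp
  also have "t + 2 * \<tau> = s + 2 * real (Suc (Suc n)) * \<tau>" by (simp add: t_def algebra_simps)
  finally show ?case by (simp add: m_def algebra_simps)
qed

end

section \<open>The reaction term and the front\<close>

context ignition_nonlinearity begin

lemma f_Lipschitz: obtains K where "K > 0" "\<And>t a b. \<bar>f t a - f t b\<bar> \<le> K * \<bar>a - b\<bar>"
proof -
  obtain K0 where K0: "\<And>t w. w \<ge> 0 \<Longrightarrow> \<bar>fu t w\<bar> \<le> K0"
    using f_u_bounded unfolding bounded_iff by force
  define K where "K = max K0 1"
  have nonneg: "\<bar>f t a - f t b\<bar> \<le> K * \<bar>a - b\<bar>" if "a \<ge> 0" "b \<ge> 0" for t a b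
  proof -
    have "norm (f t a - f t b) \<le> K * norm (a - b)"
    proof (rule field_differentiable_bound[of "{0..}"])
      show "(f t has_real_derivative fu t w) (at w within {0..})" if "w \<in> {0..}" for w
        using f_u that by simp
      show "norm (fu t w) \<le> K" if "w \<in> {0..}" for w
        using K0[of w t] that by (simp add: K_def)
    qed (use that in auto)
    then show ?thesis by simp
  qed
  have f0: "f t 0 = 0" for t
    using fmin_fmax_zero[of 0] f_between[of 0 t] \<theta> by simp
  \<comment> \<open>The extension by zero is Lipschitz across \<open>0\<close> because \<open>f t 0 = 0\<close>.\<close>
  have mixed: "\<bar>f t a - f t b\<bar> \<le> K * \<bar>a - b\<bar>" if "a \<ge> 0" "b < 0" for t a b
  proof -
    have "\<bar>f t a - f t b\<bar> \<le> K * \<bar>a - 0\<bar>"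
      using nonneg[of a 0 t] that f0 f_extension by simp
    also have "\<dots> \<le> K * \<bar>a - b\<bar>" using that by (intro mult_left_mono) (auto simp: K_def)
    finally show ?thesis .
  qed
  have "\<bar>f t a - f t b\<bar> \<le> K * \<bar>a - b\<bar>" for t a b
    using nonneg[of a b t] mixed[of a b t] mixed[of b a t] f_extension[of a t] f_extension[of b t]
    by (cases "a \<ge> 0"; cases "b \<ge> 0") (auto simp: abs_minus_commute K_def)
  moreover have "K > 0" by (simp add: K_def)
  ultimately show thesis using that by blast
qed

lemma f_decreasing_near_1:
  assumes "\<theta>\<^sub>1 \<le> a" "a \<le> b" "b \<le> 2"
  shows "f t b - f t a \<le> - \<beta>\<^sub>1 * (b - a)"
proof -
  have "- (f t a + \<beta>\<^sub>1 * a) \<le> - (f t b + \<beta>\<^sub>1 * b)"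
  proof (rule DERIV_nonneg_imp_nondecreasing[OF assms(2)])
    fix w assume w: "a \<le> w" "w \<le> b"
    have "(f t has_real_derivative fu t w) (at w within {0<..})"
      by (rule DERIV_subset[OF f_u]) (use w assms \<theta> \<theta>\<^sub>1 in auto)
    then have "(f t has_real_derivative fu t w) (at w)"
      using at_within_open[of w "{0<..}"] w assms \<theta> \<theta>\<^sub>1 by simp
    then have "((\<lambda>w. - (f t w + \<beta>\<^sub>1 * w)) has_real_derivative - (fu t w + \<beta>\<^sub>1)) (at w)"
      by (auto intro!: derivative_eq_intros)
    moreover have "fu t w \<le> - \<beta>\<^sub>1" by (rule f_u_le) (use w assms in auto)
    ultimately show "\<exists>y. ((\<lambda>w. - (f t w + \<beta>\<^sub>1 * w)) has_real_derivative y) (at w) \<and> 0 \<le> y"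
      by force
  qed
  then show ?thesis by (simp add: algebra_simps)
qed

lemma f_ignition_zero: assumes "w \<le> \<theta>" shows "f t w = 0"
proof (cases "w < 0")
  case False
  then have "w \<in> {0..\<theta>} \<union> {1}" "w \<in> {0..1}" using assms \<theta> by auto
  then show ?thesis using fmin_fmax_zero[of w] f_between[of w t] by force
qed (use f_extension in auto)

end

context limiting_front begin

lemma u_solves: "solves_on J f UNIV u"
  using u_front by (simp add: transition_front_def)

lemma u_BC: "u t \<in> BC"
  using u_solves by (auto simp: solves_on_def intro: BUC_imp_BC)

lemma u_deriv:
  "((\<lambda>\<tau>. u \<tau> x) has_real_derivative (conv J (u t) x - u t x + f t (u t x))) (at t)"
  using u_solves by (simp add: solves_on_def)

lemma u_limits: "(u t \<longlongrightarrow> 1) at_bot" "(u t \<longlongrightarrow> 0) at_top"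
  using u_front by (auto simp: transition_front_def)

lemma u_antimono: "antimono (u t)"
  by (rule antimonoI) (metis less_eq_real_def u_decreasing)

lemma u_le: "x \<le> x' \<Longrightarrow> u t x' \<le> u t x"
  using u_antimono by (rule antimonoD)

lemma u_range: "0 \<le> u t x" "u t x \<le> 1"
proof -
  show "0 \<le> u t x"
    by (rule tendsto_upperbound[OF u_limits(2)[of t]
          eventually_mono[OF eventually_ge_at_top[of x] u_le]]) simp_all
  show "u t x \<le> 1"
    by (rule tendsto_lowerbound[OF u_limits(1)[of t]
          eventually_mono[OF eventually_le_at_bot[of x] u_le]]) simp_all
qed

lemma X_deriv: "(X has_real_derivative deriv X t) (at t)"
proof -
  have "X differentiable at t" using X_C1 by (simp add: C1_differentiable_on_eq)
  then show ?thesis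
    by (simp add: DERIV_deriv_iff_real_differentiable)
qed

lemma X_increment:
  assumes "s \<le> t" shows "X s \<le> X t" "X t \<le> X s + c_max * (t - s)"
proof -
  show "X s \<le> X t"
  proof (rule DERIV_nonneg_imp_nondecreasing[OF assms])
    fix w show "\<exists>y. (X has_real_derivative y) (at w) \<and> 0 \<le> y"
      using X_deriv[of w] X_speed[of w] constants_pos(1) by (intro exI[of _ "deriv X w"]) auto
  qed
  have "c_max * s - X s \<le> c_max * t - X t"
  proof (rule DERIV_nonneg_imp_nondecreasing[OF assms])
    fix w
    have "((\<lambda>w. c_max * w - X w) has_real_derivative (c_max - deriv X w)) (at w)"
      by (auto intro!: derivative_eq_intros X_deriv)
    then show "\<exists>y. ((\<lambda>w. c_max * w - X w) has_real_derivative y) (at w) \<and> 0 \<le> y"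
      using X_speed[of w] by force
  qed
  then show "X t \<le> X s + c_max * (t - s)" by (simp add: algebra_simps)
qed

text \<open>
  The integrating factor \<open>exp ((1 + K) t)\<close> turns \<open>w\<^sub>t \<ge> J * w - (1 + K) w\<close> for \<open>w(t,x) = u(t,x) - u(t,x+h)\<close> into
  \<open>W\<^sub>t \<ge> J * W \<ge> 0\<close>.  Hence \<open>W\<close> increases in time, so \<open>J * W\<close> does too, and the bound follows with the value of
  \<open>J * W\<close> at the earlier time.
\<close>

lemma difference_growth:
  assumes K: "\<And>t a b. \<bar>f t a - f t b\<bar> \<le> K * \<bar>a - b\<bar>" and h: "h \<ge> 0"
  defines "W \<equiv> \<lambda>t x. exp ((1 + K) * t) * (u t x - u t (x + h))"
  assumes t: "t \<le> t'"
  shows "W t' x \<ge> (t' - t) * conv J (W t) x"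
proof -
  have W_BC: "W t \<in> BC" for t
    unfolding W_def by (intro BC_cmult BC_diff BC_shift u_BC)
  have W_nonneg: "W t x \<ge> 0" for t x
    unfolding W_def using h by (auto intro!: mult_nonneg_nonneg u_le)
  have deriv: "\<exists>D. ((\<lambda>t. W t x) has_real_derivative D) (at t) \<and> D \<ge> conv J (W t) x" for t x
  proof -
    define w where "w = u t x - u t (x + h)"
    define w' where "w' = conv J (u t) x - u t x + f t (u t x)
        - (conv J (u t) (x + h) - u t (x + h) + f t (u t (x + h)))"
    have w: "w \<ge> 0" unfolding w_def using h by (simp add: u_le)
    have "((\<lambda>t. W t x) has_real_derivative
        (exp ((1 + K) * t) * (1 + K) * w + w' * exp ((1 + K) * t))) (at t)"
      unfolding W_def w_def w'_def
      by (rule derivative_eq_intros u_deriv refl | simp)+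
    moreover have "conv J (W t) x = exp ((1 + K) * t) * (conv J (u t) x - conv J (u t) (x + h))"
      unfolding W_def conv_cmult by (simp add: conv_diff u_BC BC_shift conv_shift)
    moreover have "(1 + K) * w + w' \<ge> conv J (u t) x - conv J (u t) (x + h)"
      using K[of t "u t x" "u t (x + h)"] w by (simp add: w'_def w_def algebra_simps)
    then have "exp ((1 + K) * t) * ((1 + K) * w + w')
        \<ge> exp ((1 + K) * t) * (conv J (u t) x - conv J (u t) (x + h))"
      by (rule mult_left_mono) simp
    ultimately show ?thesis by (auto simp: algebra_simps intro!: exI)
  qed
  have conv_nonneg: "conv J (W t) x \<ge> 0" for t x
    using conv_mono[OF BC_const[of 0] W_BC, of t x] W_nonneg by (simp add: conv_const)
  have mono: "W s x \<le> W s' x" if "s \<le> s'" for s s' x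
  proof (rule DERIV_nonneg_imp_nondecreasing[OF that])
    fix r show "\<exists>y. ((\<lambda>t. W t x) has_real_derivative y) (at r) \<and> 0 \<le> y"
      using deriv[of x r] conv_nonneg[of r x] by force
  qed
  define \<kappa> where "\<kappa> = conv J (W t) x"
  have "W t x - \<kappa> * t \<le> W t' x - \<kappa> * t'"
  proof (rule DERIV_nonneg_imp_nondecreasing[OF t])
    fix r assume r: "t \<le> r" "r \<le> t'"
    obtain D where D: "((\<lambda>t. W t x) has_real_derivative D) (at r)" "D \<ge> conv J (W r) x"
      using deriv by blast
    have "((\<lambda>t. W t x - \<kappa> * t) has_real_derivative (D - \<kappa>)) (at r)"
      by (auto intro!: derivative_eq_intros D)
    moreover have "\<kappa> \<le> conv J (W r) x"
      unfolding \<kappa>_def by (intro conv_mono W_BC mono r)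
    ultimately show "\<exists>y. ((\<lambda>t. W t x - \<kappa> * t) has_real_derivative y) (at r) \<and> 0 \<le> y"
      using D(2) by (intro exI[of _ "D - \<kappa>"]) auto
  qed
  then show ?thesis using W_nonneg[of t x] by (simp add: \<kappa>_def algebra_simps)
qed

text \<open>
  A quantitative substitute for \<open>u\<^sub>x \<le> - \<delta>\<close> near the interface, uniform in time.  At time \<open>t - 1\<close> the front drops by
  at least \<open>1/2\<close> on \<open>{X - M\<^sub>1..X + M\<^sub>1}\<close>, so by pigeonhole it drops by \<open>d = 1/(2N)\<close> on some interval of length \<open>r/2\<close>; the
  resulting mass \<open>h d\<close> of the difference spreads over \<open>{X t - M..X t + M}\<close> within one time unit.
\<close>

lemma steepness:
  assumes cutoff: "cutoff_width u X \<theta> \<theta>\<^sub>1 M\<^sub>1"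
  obtains \<delta> h\<^sub>0 where "\<delta> > 0" "h\<^sub>0 > 0"
    "\<And>t x h. \<bar>x - X t\<bar> \<le> M \<Longrightarrow> 0 \<le> h \<Longrightarrow> h \<le> h\<^sub>0 \<Longrightarrow> u t x - u t (x + h) \<ge> \<delta> * h"
proof -
  obtain p r c where J_low: "\<And>w. \<bar>w - p\<bar> \<le> r \<Longrightarrow> J w \<ge> c" and rc: "r > 0" "c > 0"
    using J_lower_bound by metis
  obtain K where K: "K > 0" "\<And>t a b. \<bar>f t a - f t b\<bar> \<le> K * \<bar>a - b\<bar>"
    using f_Lipschitz by blast
  obtain N where N: "4 * M\<^sub>1 / r \<le> real N" using real_arch_simple by blast
  have M1: "M\<^sub>1 > 0" "\<And>t x. x - X t \<le> - M\<^sub>1 \<Longrightarrow> u t x \<ge> (1 + \<theta>\<^sub>1) / 2"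
    "\<And>t x. x - X t \<ge> M\<^sub>1 \<Longrightarrow> u t x \<le> \<theta> / 2"
    using cutoff by (auto simp: cutoff_width_def)
  have "4 * M\<^sub>1 / r > 0" using M1(1) rc by simp
  then have N_pos: "N > 0" using N by (cases N) auto
  have N': "4 * M\<^sub>1 \<le> real N * r" using N rc by (simp add: field_simps)
  define d where "d = 1 / (2 * real N)"
  have d: "d > 0" using N_pos by (simp add: d_def)
  \<comment> \<open>\<open>n\<close> double steps must cover the distance to the far end: window, drift of \<open>X\<close> and the position of the drop.\<close>
  obtain n where n: "(M + M\<^sub>1 + r + c_max) / r + real N \<le> real n" using real_arch_simple by blast
  have n': "M + M\<^sub>1 + r + c_max + real N * r \<le> real n * r" using n rc by (simp add: field_simps)
  define \<tau> where "\<tau> = 1 / (2 * real (Suc n))"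
  have \<tau>: "\<tau> > 0" "2 * real (Suc n) * \<tau> = 1" by (auto simp: \<tau>_def)
  define \<delta> where "\<delta> = exp (- (1 + K)) * (\<tau> * c * d * (\<tau> * (c * r / 2)) ^ (2 * n + 1))"
  show thesis
  proof (rule that[of \<delta> "r / 2"])
    show "\<delta> > 0" unfolding \<delta>_def using rc d \<tau> by (auto intro!: mult_pos_pos)
    show "r / 2 > 0" using rc by simp
    fix t x h assume x: "\<bar>x - X t\<bar> \<le> M" and h: "0 \<le> h" "h \<le> r / 2"
    define s where "s = t - 1"
    define a where "a i = X s - M\<^sub>1 + real i * (r / 2)" for i
    have "\<exists>i<N. u s (a i) - u s (a (Suc i)) \<ge> d"
    proof (rule ccontr)
      assume "\<not> ?thesis"
      then have "(\<Sum>i<N. u s (a i) - u s (a (Suc i))) < real (card {..<N}) * d"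
        by (intro sum_bounded_above_strict) (use N_pos in \<open>auto simp: not_le\<close>)
      then have "u s (a 0) - u s (a N) < 1/2"
        using N_pos by (simp add: sum_lessThan_telescope'[of "\<lambda>i. u s (a i)"] d_def)
      moreover have "u s (a 0) \<ge> (1 + \<theta>\<^sub>1) / 2" "u s (a N) \<le> \<theta> / 2"
        using M1(2)[where x = "a 0" and t = s] M1(3)[where x = "a N" and t = s] N'
        by (auto simp: a_def)
      ultimately show False using \<theta>\<^sub>1 by (simp add: field_simps)
    qed
    then obtain i where i: "i < N" "u s (a i) - u s (a (Suc i)) \<ge> d" by blast
    \<comment> \<open>The shift by \<open>h \<le> r/2\<close> leaves the interval of the drop inside \<open>{z + h..z + r}\<close>.\<close>
    define z where "z = a i - h"
    define W where "W = (\<lambda>t x. exp ((1 + K) * t) * (u t x - u t (x + h)))"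
    have "h * d \<le> h * (u s (z + h) - u s (z + r))"
    proof (rule mult_left_mono)
      have "u s (z + r) \<le> u s (a (Suc i))"
        by (rule u_le) (use h in \<open>simp add: z_def a_def field_simps\<close>)
      then show "d \<le> u s (z + h) - u s (z + r)" using i(2) by (simp add: z_def)
    qed (rule h)
    also have "\<dots> \<le> integral {z..z+r} (\<lambda>v. u s v - u s (v + h))"
      by (rule integral_difference_antimono[OF _ u_antimono])
         (use u_BC[of s] h in \<open>auto simp: BC_def\<close>)
    finally have "exp ((1 + K) * s) * (h * d)
        \<le> exp ((1 + K) * s) * integral {z..z+r} (\<lambda>v. u s v - u s (v + h))"
      by (rule mult_left_mono) simp
    also have "\<dots> = integral {z..z+r} (W s)" by (simp add: W_def)
    finally have mass: "exp ((1 + K) * s) * (h * d) \<le> integral {z..z+r} (W s)" .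
    have "0 \<le> real i * r" "real i * r \<le> real N * r" using i(1) rc by auto
    moreover have "X s \<le> X t" "X t \<le> X s + c_max"
      using X_increment[of s t] by (auto simp: s_def)
    moreover have "z = X s - M\<^sub>1 + real i * r / 2 - h" by (simp add: z_def a_def)
    moreover have "x - X t \<le> M" "X t - x \<le> M" using x by auto
    ultimately have "z - real n * r \<le> x" "x \<le> z + r + real n * r"
      using n' h M1(1) rc(1) by linarith+
    then have x_in: "x \<in> {z - real n * r..z + r + real n * r}" by simp
    have "W (s + 2 * real (Suc n) * \<tau>) x
        \<ge> \<tau> * c * (exp ((1 + K) * s) * (h * d)) * (\<tau> * (c * r / 2)) ^ (2 * n + 1)"
    proof (rule positivity_spreads[where p = p and z = z and W = W,
          OF J_low rc(1) _ _ _ _ _ mass _ x_in])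
      show "W t \<in> BC" for t
        unfolding W_def by (intro BC_cmult BC_diff BC_shift u_BC)
      show "W t x \<ge> 0" for t x
        unfolding W_def using h by (auto intro!: mult_nonneg_nonneg u_le)
      show "W t' x \<ge> (t' - t) * conv J (W t) x" if "t \<le> t'" for t t' x
        unfolding W_def by (rule difference_growth[OF K(2) h(1) that])
    qed (use rc \<tau> d h in auto)
    moreover have "s + 2 * real (Suc n) * \<tau> = t" unfolding \<tau>(2) by (simp add: s_def)
    moreover have "exp ((1 + K) * s) = exp ((1 + K) * t) * exp (- (1 + K))"
      by (simp add: s_def algebra_simps flip: exp_add)
    ultimately have "exp ((1 + K) * t) * (u t x - u t (x + h)) \<ge> exp ((1 + K) * t) * (\<delta> * h)"
      by (simp add: W_def \<delta>_def mult_ac)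
    then show "u t x - u t (x + h) \<ge> \<delta> * h" by simp
  qed
qed

end

section \<open>Comparison of solutions with a shifted and perturbed front\<close>

lemma derivative_left_lower_bound:
  fixes H :: "real \<Rightarrow> real"
  assumes "(H has_real_derivative L) (at t)" "e > 0"
  shows "\<forall>\<^sub>F \<tau> in at_left t. H t - H \<tau> \<ge> (L - e) * (t - \<tau>)"
proof -
  have "((\<lambda>\<tau>. (H \<tau> - H t) / (\<tau> - t)) \<longlongrightarrow> L) (at_left t)"
    using assms(1) by (auto simp: has_field_derivative_iff intro: tendsto_within_subset)
  then have "\<forall>\<^sub>F \<tau> in at_left t. L - e < (H \<tau> - H t) / (\<tau> - t)"
    by (rule order_tendstoD) (use assms(2) in simp)
  moreover have "\<forall>\<^sub>F \<tau> in at_left t. \<tau> \<in> {t - 1<..<t}"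
    by (rule eventually_at_left_real) simp
  ultimately show ?thesis
    by eventually_elim (simp add: field_simps)
qed

text \<open>
  Continuity of \<open>t \<mapsto> v t\<close> in the supremum norm bounds \<open>v\<close> near each time, and bisection
  passes from local bounds to a compact time interval.
\<close>

lemma solution_locally_bounded:
  assumes v: "solves_on J f {t\<^sub>0..} v" and t: "t\<^sub>0 \<le> t\<^sub>1"
  obtains B where "\<And>t x. t \<in> {t\<^sub>0..t\<^sub>1} \<Longrightarrow> \<bar>v t x\<bar> \<le> B"
proof -
  define P where "P a b \<longleftrightarrow> (\<exists>B. \<forall>t\<in>{a..b}. t\<^sub>0 \<le> t \<longrightarrow> (\<forall>x. \<bar>v t x\<bar> \<le> B))" for a b
  have "P t\<^sub>0 t\<^sub>1"
    using t
  proof (rule Bolzano[where P = P])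
    fix a b c assume trans: "P a b" "P b c"
    from trans(1)[unfolded P_def] obtain B where B: "\<forall>t\<in>{a..b}. t\<^sub>0 \<le> t \<longrightarrow> (\<forall>x. \<bar>v t x\<bar> \<le> B)"
      by blast
    from trans(2)[unfolded P_def] obtain B' where "\<forall>t\<in>{b..c}. t\<^sub>0 \<le> t \<longrightarrow> (\<forall>x. \<bar>v t x\<bar> \<le> B')"
      by blast
    with B have "\<bar>v t x\<bar> \<le> max B B'" if "t \<in> {a..c}" "t\<^sub>0 \<le> t" for t x
      using that by (cases "t \<le> b") (auto simp: le_max_iff_disj)
    then show "P a c" unfolding P_def by blast
  next
    fix s assume local: "t\<^sub>0 \<le> s" "s \<le> t\<^sub>1"
    have "bounded (range (v s))" "uniform_limit UNIV v (v s) (at s within {t\<^sub>0..})"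
      using v local by (auto simp: solves_on_def BUC_def)
    then obtain B where B: "\<And>x. \<bar>v s x\<bar> \<le> B"
      by (auto simp: bounded_iff)
    have "\<forall>\<^sub>F t in at s within {t\<^sub>0..}. \<forall>x\<in>UNIV. dist (v t x) (v s x) < 1"
      by (rule uniform_limitD) (use v local in \<open>auto simp: solves_on_def\<close>)
    then obtain d where d: "d > 0"
      "\<And>t x. t\<^sub>0 \<le> t \<Longrightarrow> t \<noteq> s \<Longrightarrow> dist t s < d \<Longrightarrow> dist (v t x) (v s x) < 1"
      unfolding eventually_at by auto
    have "\<bar>v t x\<bar> \<le> B + 1" if "t\<^sub>0 \<le> t" "dist t s < d" for t x
      using d(2)[of t x] B[of x] that by (cases "t = s") (auto simp: dist_real_def)
    then have "P a b" if "a \<le> s" "s \<le> b" "b - a < d" for a b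
      unfolding P_def using that
      by (intro exI[of _ "B + 1"] ballI impI allI \<open>\<And>t x. t\<^sub>0 \<le> t \<Longrightarrow> dist t s < d \<Longrightarrow> \<bar>v t x\<bar> \<le> B + 1\<close>)
         (auto simp: dist_real_def)
    then show "\<exists>d>0. \<forall>a b. a \<le> s \<and> s \<le> b \<and> b - a < d \<longrightarrow> P a b" using d(1) by blast
  qed
  then obtain B where "\<forall>t\<in>{t\<^sub>0..t\<^sub>1}. t\<^sub>0 \<le> t \<longrightarrow> (\<forall>x. \<bar>v t x\<bar> \<le> B)"
    unfolding P_def by blast
  then show thesis by (intro that[of B]) simp
qed

context limiting_front begin

lemma u_along_curve_continuous:
  assumes "isCont \<eta> t" shows "isCont (\<lambda>\<tau>. u \<tau> (\<eta> \<tau>)) t"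
proof -
  have "uniform_limit UNIV u (u t) (at t)"
    using u_solves by (auto simp: solves_on_def)
  then have "((\<lambda>\<tau>. u \<tau> (\<eta> \<tau>) - u t (\<eta> \<tau>)) \<longlongrightarrow> 0) (at t)"
    unfolding tendsto_iff uniform_limit_iff by (auto simp: dist_real_def elim!: eventually_mono)
  moreover have "isCont (u t) (\<eta> t)"
    using u_BC[of t] by (simp add: BC_def continuous_on_eq_continuous_at)
  then have "((\<lambda>\<tau>. u t (\<eta> \<tau>)) \<longlongrightarrow> u t (\<eta> t)) (at t)"
    by (rule isCont_tendsto_compose) (use assms in \<open>simp add: isCont_def\<close>)
  ultimately have "((\<lambda>\<tau>. (u \<tau> (\<eta> \<tau>) - u t (\<eta> \<tau>)) + u t (\<eta> \<tau>)) \<longlongrightarrow> 0 + u t (\<eta> t)) (at t)"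
    by (rule tendsto_add)
  then show ?thesis by (simp add: isCont_def)
qed

text \<open>
  The value \<open>\<sigma> = 1\<close> stands for the supersolution and \<open>\<sigma> = - 1\<close> for the subsolution, so both are treated by one
  nonnegative quantity \<open>D\<close>.  The hypothesis \<open>barrier\<close> is the inequality between the error terms from the reaction
  and the dispersal of the weight, on the left, and, on the right, the gain from the moving shift on the interface, the
  loss from the decay of \<open>q\<close> and the gain from the transport of the weight.  The terms of the front itself cancel because \<open>u\<close> solves the equation.
\<close>

lemma shifted_front_comparison:
  fixes \<sigma> :: real and \<rho> q G G' :: "real \<Rightarrow> real"
  assumes \<sigma>: "\<sigma> = 1 \<or> \<sigma> = - 1"
    and K: "K > 0" "\<And>t a b. \<bar>f t a - f t b\<bar> \<le> K * \<bar>a - b\<bar>"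
    and G: "\<And>z. 0 \<le> G z" "\<And>z. G z \<le> 1" "\<And>z. (G has_real_derivative G' z) (at z)"
    and \<rho>: "\<And>t. (\<rho> has_real_derivative A * q t) (at t)" "mono \<rho>"
    and q: "\<And>t. (q has_real_derivative - \<omega> * q t) (at t)" "\<And>t. t \<ge> t\<^sub>0 \<Longrightarrow> q t \<ge> 0"
    and h\<^sub>0: "h\<^sub>0 > 0"
    and steep: "\<And>t x h. \<bar>x - X t\<bar> \<le> M + 1 \<Longrightarrow> 0 \<le> h \<Longrightarrow> h \<le> h\<^sub>0 \<Longrightarrow> u t x - u t (x + h) \<ge> \<delta> * h"
    and barrier: "\<And>t z. t \<ge> t\<^sub>0 \<Longrightarrow>
      \<sigma> * (f t (u t (X t + z) + \<sigma> * (q t * G z)) - f t (u t (X t + z))) + q t * (conv J G z - G z)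
        \<le> (if \<bar>z\<bar> \<le> M then \<delta> else 0) * (A * q t) - \<omega> * q t * G z
          - q t * G' z * (deriv X t + \<sigma> * (A * q t))"
    and v: "solves_on J f {t\<^sub>0..} v"
    and init: "\<And>x. \<sigma> * (u t\<^sub>0 (x - (\<zeta> + \<sigma> * \<rho> t\<^sub>0)) - v t\<^sub>0 x)
        + q t\<^sub>0 * G (x - (\<zeta> + \<sigma> * \<rho> t\<^sub>0) - X t\<^sub>0) \<ge> 0"
    and t: "t \<ge> t\<^sub>0"
  shows "\<sigma> * (u t (x - (\<zeta> + \<sigma> * \<rho> t)) - v t x) + q t * G (x - (\<zeta> + \<sigma> * \<rho> t) - X t) \<ge> 0"
proof -
  define D where "D = (\<lambda>t x. \<sigma> * (u t (x - (\<zeta> + \<sigma> * \<rho> t)) - v t x)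
      + q t * G (x - (\<zeta> + \<sigma> * \<rho> t) - X t))"
  have G_cont: "isCont G z" for z using G(3) by (rule DERIV_isCont)
  have G_BC: "G \<in> BC"
    by (rule BC_I[of _ 1]) (use G G_cont in \<open>auto simp: continuous_on_eq_continuous_at\<close>)
  have v_BC: "v t \<in> BC" if "t \<ge> t\<^sub>0" for t
    using v that by (auto simp: solves_on_def intro: BUC_imp_BC)
  have v_deriv: "((\<lambda>\<tau>. v \<tau> x) has_real_derivative (conv J (v t) x - v t x + f t (v t x)))
      (at t within {t\<^sub>0..})" if "t \<ge> t\<^sub>0" for t x
    using v that by (auto simp: solves_on_def)
  have cont: "continuous_on {t\<^sub>0..t} (\<lambda>\<tau>. D \<tau> x)" for x
  proof -
    have *: "isCont (\<lambda>\<tau>. x - (\<zeta> + \<sigma> * \<rho> \<tau>)) \<tau>" for \<tau>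
      by (intro continuous_intros DERIV_isCont[OF \<rho>(1)])
    have "isCont (\<lambda>\<tau>. x - (\<zeta> + \<sigma> * \<rho> \<tau>) - X \<tau>) \<tau>" for \<tau>
      by (intro continuous_intros * DERIV_isCont[OF X_deriv])
    then have "isCont (\<lambda>\<tau>. G (x - (\<zeta> + \<sigma> * \<rho> \<tau>) - X \<tau>)) \<tau>" for \<tau>
      by (rule isCont_o2[OF _ G_cont])
    then have "continuous_on {t\<^sub>0..t} (\<lambda>\<tau>. q \<tau> * G (x - (\<zeta> + \<sigma> * \<rho> \<tau>) - X \<tau>))"
      by (intro continuous_at_imp_continuous_on ballI continuous_intros DERIV_isCont[OF q(1)])
    moreover have "continuous_on {t\<^sub>0..t} (\<lambda>\<tau>. u \<tau> (x - (\<zeta> + \<sigma> * \<rho> \<tau>)))"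
      by (intro continuous_at_imp_continuous_on ballI u_along_curve_continuous *)
    moreover have "continuous_on {t\<^sub>0..t} (\<lambda>\<tau>. v \<tau> x)"
      by (rule continuous_on_subset[of "{t\<^sub>0..}"], rule DERIV_continuous_on[OF v_deriv]) auto
    ultimately show ?thesis unfolding D_def
      by (intro continuous_on_add continuous_on_mult_left continuous_on_diff)
  qed
  obtain B where B: "\<And>\<tau> x. \<tau> \<in> {t\<^sub>0..t} \<Longrightarrow> \<bar>v \<tau> x\<bar> \<le> B"
    using solution_locally_bounded[OF v t] by blast
  have bound: "D \<tau> x \<ge> - (1 + B)" if "\<tau> \<in> {t\<^sub>0..t}" for \<tau> x
  proof -
    have "\<bar>\<sigma> * (u \<tau> (x - (\<zeta> + \<sigma> * \<rho> \<tau>)) - v \<tau> x)\<bar> \<le> 1 + B"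
      using u_range[of \<tau> "x - (\<zeta> + \<sigma> * \<rho> \<tau>)"] B[OF that, of x] \<sigma> by auto
    moreover have "q \<tau> * G (x - (\<zeta> + \<sigma> * \<rho> \<tau>) - X \<tau>) \<ge> 0"
      using q(2) G(1) that by auto
    ultimately show ?thesis unfolding D_def by linarith
  qed
  have dini: "\<forall>\<^sub>F \<tau> in at_left s. D s x - D \<tau> x \<ge> - ((1 + K) * S + e) * (s - \<tau>)"
    if s: "t\<^sub>0 < s" and neg: "D s x < 0" and S: "\<And>y. D s y \<ge> - S" and e: "e > 0" for s x S e
  proof -
    define \<xi> where "\<xi> = x - (\<zeta> + \<sigma> * \<rho> s)"
    define z where "z = \<xi> - X s"
    \<comment> \<open>The guaranteed slope of the front at \<open>\<xi>\<close>; away from the interface only monotonicity is used.\<close>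
    define m where "m = (if \<bar>z\<bar> \<le> M then \<delta> else 0)"
    \<comment> \<open>\<open>H\<close> replaces the nondifferentiable part of \<open>D\<close>, the effect of the moving shift on \<open>u\<close>, by its lower bound \<open>m * \<rho>\<close>.\<close>
    define H where "H = (\<lambda>\<tau>. \<sigma> * (u \<tau> \<xi> - v \<tau> x)
        + q \<tau> * G (x - (\<zeta> + \<sigma> * \<rho> \<tau>) - X \<tau>) + m * \<rho> \<tau>)"
    define L where "L = \<sigma> * ((conv J (u s) \<xi> - u s \<xi> + f s (u s \<xi>))
        - (conv J (v s) x - v s x + f s (v s x)))
      + (- \<omega> * q s * G z + q s * (G' z * (- (\<sigma> * (A * q s)) - deriv X s))) + m * (A * q s)"
    have "((\<lambda>\<tau>. v \<tau> x) has_real_derivative (conv J (v s) x - v s x + f s (v s x))) (at s)"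
      using v_deriv[of s x] s at_within_interior[of s "{t\<^sub>0..}"] by simp
    moreover have "((\<lambda>\<tau>. G (x - (\<zeta> + \<sigma> * \<rho> \<tau>) - X \<tau>)) has_real_derivative
        G' z * (- (\<sigma> * (A * q s)) - deriv X s)) (at s)"
    proof -
      have "(G has_real_derivative G' z) (at (x - (\<zeta> + \<sigma> * \<rho> s) - X s))"
        using G(3)[of z] by (simp add: z_def \<xi>_def)
      moreover have "((\<lambda>\<tau>. x - (\<zeta> + \<sigma> * \<rho> \<tau>) - X \<tau>) has_real_derivative
          - (\<sigma> * (A * q s)) - deriv X s) (at s)"
        by (auto intro!: derivative_eq_intros \<rho> X_deriv)
      ultimately show ?thesis by (rule DERIV_chain2)
    qed
    ultimately have "(H has_real_derivative L) (at s)"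
      unfolding H_def L_def
      by (auto intro!: derivative_eq_intros u_deriv \<rho> q simp: z_def \<xi>_def algebra_simps)
    then have H_incr: "\<forall>\<^sub>F \<tau> in at_left s. H s - H \<tau> \<ge> (L - e) * (s - \<tau>)"
      by (rule derivative_left_lower_bound[OF _ e])
    have before: "\<forall>\<^sub>F \<tau> in at_left s. \<tau> \<in> {s - 1<..<s}"
      by (rule eventually_at_left_real) simp
    have X_near: "\<forall>\<^sub>F \<tau> in at_left s. dist (X \<tau>) (X s) < 1/2"
    proof (rule tendstoD)
      show "(X \<longlongrightarrow> X s) (at_left s)"
        using DERIV_isCont[OF X_deriv, of s] by (auto simp: isCont_def intro: tendsto_within_subset)
    qed simp
    have \<rho>_near: "\<forall>\<^sub>F \<tau> in at_left s. dist (\<rho> \<tau>) (\<rho> s) < min h\<^sub>0 (1/2)"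
    proof (rule tendstoD)
      show "(\<rho> \<longlongrightarrow> \<rho> s) (at_left s)"
        using DERIV_isCont[OF \<rho>(1), of s] by (auto simp: isCont_def intro: tendsto_within_subset)
    qed (use h\<^sub>0 in simp)
    have L_low: "L \<ge> - ((1 + K) * S)"
    proof -
      define V where "V = u s \<xi> + \<sigma> * (q s * G z)"
      have D_eq: "D s x = \<sigma> * (V - v s x)"
        using \<sigma> by (auto simp: D_def V_def z_def \<xi>_def algebra_simps)
      have conv_D: "conv J (D s) x = \<sigma> * (conv J (u s) \<xi> - conv J (v s) x) + q s * conv J G z"
      proof -
        define k l where "k = - (\<zeta> + \<sigma> * \<rho> s)" and "l = - (\<zeta> + \<sigma> * \<rho> s) - X s"
        have "D s = (\<lambda>y. \<sigma> * (u s (y + k) - v s y) + q s * G (y + l))"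
          by (rule ext) (simp add: D_def k_def l_def algebra_simps)
        then have "conv J (D s) x = conv J (\<lambda>y. \<sigma> * (u s (y + k) - v s y) + q s * G (y + l)) x"
          by (simp only:)
        also have "\<dots> = \<sigma> * (conv J (u s) (x + k) - conv J (v s) x) + q s * conv J G (x + l)"
          using s by (simp add: conv_add conv_cmult conv_diff conv_shift BC_cmult BC_diff BC_shift
              u_BC v_BC G_BC)
        finally show ?thesis by (simp add: k_def l_def z_def \<xi>_def algebra_simps)
      qed
      have D_BC: "D s \<in> BC"
      proof -
        define k l where "k = - (\<zeta> + \<sigma> * \<rho> s)" and "l = - (\<zeta> + \<sigma> * \<rho> s) - X s"
        have "D s = (\<lambda>y. \<sigma> * (u s (y + k) - v s y) + q s * G (y + l))"
          by (rule ext) (simp add: D_def k_def l_def algebra_simps)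
        then show ?thesis
          using s by (simp add: BC_add BC_cmult BC_diff BC_shift u_BC v_BC G_BC)
      qed
      have conv_low: "conv J (D s) x \<ge> - S"
        using conv_mono[OF BC_const[of "- S"] D_BC, of x] S by (simp add: conv_const)
      have "\<bar>f s V - f s (v s x)\<bar> \<le> K * \<bar>V - v s x\<bar>" by (rule K)
      also have "\<bar>V - v s x\<bar> = - D s x" using \<sigma> neg D_eq by auto
      also have "K * (- D s x) \<le> K * S" using K(1) S[of x] by (intro mult_left_mono) auto
      finally have "\<sigma> * (f s V - f s (v s x)) \<ge> - (K * S)" using \<sigma> by auto
      moreover have "\<sigma> * (f s V - f s (u s \<xi>)) + q s * (conv J G z - G z)
          \<le> m * (A * q s) - \<omega> * q s * G z - q s * G' z * (deriv X s + \<sigma> * (A * q s))"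
        using barrier[of s z] s by (simp add: m_def V_def z_def)
      moreover have "L = conv J (D s) x - D s x + \<sigma> * (f s V - f s (v s x))
          + (m * (A * q s) - \<omega> * q s * G z - q s * G' z * (deriv X s + \<sigma> * (A * q s))
            - (\<sigma> * (f s V - f s (u s \<xi>)) + q s * (conv J G z - G z)))"
      proof -
        have "\<sigma> * \<sigma> = 1" using \<sigma> by auto
        then have "\<sigma> * (\<sigma> * (q s * G z)) = q s * G z" by (simp add: mult.assoc[symmetric])
        then show ?thesis
          unfolding L_def conv_D unfolding D_eq V_def by (simp add: algebra_simps)
      qed
      ultimately show ?thesis using conv_low neg by (simp add: algebra_simps)
    qed
    from H_incr before X_near \<rho>_near show ?thesis
    proof eventually_elim
      case (elim \<tau>)
      define h where "h = \<rho> s - \<rho> \<tau>"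
      have h: "0 \<le> h" "h \<le> h\<^sub>0" "h \<le> 1/2"
        using monoD[OF \<rho>(2), of \<tau> s] elim by (auto simp: h_def dist_real_def)
      have shift: "x - (\<zeta> + \<sigma> * \<rho> \<tau>) = \<xi> + \<sigma> * h"
        by (simp add: \<xi>_def h_def algebra_simps)
      \<comment> \<open>For \<open>\<sigma> = - 1\<close> the difference starts at \<open>\<xi> - h\<close>; both base points lie within \<open>M + 1\<close> of \<open>X \<tau>\<close>.\<close>
      have gain: "\<sigma> * (u \<tau> \<xi> - u \<tau> (\<xi> + \<sigma> * h)) \<ge> m * h"
      proof (cases "\<bar>z\<bar> \<le> M")
        case True
        have near: "\<bar>\<xi> - X \<tau>\<bar> \<le> M + 1" "\<bar>\<xi> - h - X \<tau>\<bar> \<le> M + 1"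
          using True elim(3) h(1,3) unfolding z_def dist_real_def by linarith+
        show ?thesis
          using \<sigma> steep[OF near(1) h(1,2)] steep[OF near(2) h(1,2)] True by (auto simp: m_def)
      next
        case False
        then show ?thesis using \<sigma> h(1) u_le by (auto simp: m_def)
      qed
      have "(L - e) * (s - \<tau>) \<ge> (- ((1 + K) * S) - e) * (s - \<tau>)"
        using elim(2) L_low by (intro mult_right_mono) auto
      moreover have "D s x - D \<tau> x = H s - H \<tau> - m * h + \<sigma> * (u \<tau> \<xi> - u \<tau> (\<xi> + \<sigma> * h))"
        unfolding D_def H_def h_def shift[unfolded h_def] \<xi>_def[symmetric]
        by (simp add: algebra_simps)
      ultimately show ?case using elim(1) gain by (simp add: algebra_simps)
    qed
  qed
  have "D t x \<ge> 0"
  proof (rule comparison[of "1 + K" t\<^sub>0 t D "1 + B" t])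
    show "D t\<^sub>0 x \<ge> 0" for x using init by (simp add: D_def)
    show "\<forall>\<^sub>F \<tau> in at_left s. D s x - D \<tau> x \<ge> - ((1 + K) * S + e) * (s - \<tau>)"
      if "t\<^sub>0 < s" "s \<le> t" "D s x < 0" "\<And>y. D s y \<ge> - S" "e > 0" for s x S e
      by (rule dini) (use that in auto)
  qed (use K(1) cont bound t in auto)
  then show ?thesis by (simp add: D_def)
qed

end

section \<open>Exponential moments of the kernel and decay of the weight\<close>

lemma exp_plus_exp_minus_le: "exp x + exp (- x) - 2 \<le> x\<^sup>2 * exp \<bar>x\<bar>" for x :: real
proof -
  \<comment> \<open>The left-hand side is \<open>exp (- a) * (exp a - 1)\<^sup>2\<close>, and \<open>exp a - 1 \<le> a * exp a\<close>.\<close>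
  define a where "a = \<bar>x\<bar>"
  have "(1 - a) * exp a \<le> exp (- a) * exp a"
    using exp_ge_add_one_self[of "- a"] by (intro mult_right_mono) auto
  then have "exp a - 1 \<le> a * exp a" by (simp add: algebra_simps flip: exp_add)
  then have "(exp a - 1)\<^sup>2 \<le> (a * exp a)\<^sup>2"
    by (intro power_mono) (auto simp: a_def)
  then have "exp (- a) * (exp a - 1)\<^sup>2 \<le> exp (- a) * (a * exp a)\<^sup>2"
    by (rule mult_left_mono) simp
  moreover have inv: "exp (- a) * exp a = 1" by (simp flip: exp_add)
  have "exp (- a) * (exp a - 1)\<^sup>2 = (exp (- a) * exp a) * exp a - 2 * (exp (- a) * exp a) + exp (- a)"
    by (simp add: power2_eq_square algebra_simps)
  moreover have "exp (- a) * (a * exp a)\<^sup>2 = a\<^sup>2 * (exp (- a) * exp a) * exp a"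
    by (simp add: power2_eq_square algebra_simps)
  ultimately have "exp a + exp (- a) - 2 \<le> a\<^sup>2 * exp a" unfolding inv by simp
  then show ?thesis by (cases "x \<ge> 0") (auto simp: a_def)
qed

lemma square_le_exp_abs: "x\<^sup>2 \<le> 2 * exp \<bar>x\<bar>" for x :: real
  using exp_lower_Taylor_quadratic[of "\<bar>x\<bar>"] by simp

context dispersal_kernel begin

definition moment :: "real \<Rightarrow> real" where
  "moment a = (\<integral>w. J w * exp (a * w) \<partial>lborel)"

lemma moment_integrable: "integrable lborel (\<lambda>w. J w * exp (a * w))"
proof -
  consider "a > 0" | "a = 0" | "- a > 0" by linarith
  then show ?thesis
  proof cases
    case 3
    have "integrable lborel (\<lambda>w. J (0 + - 1 * w) * exp (- a * (0 + - 1 * w)))"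
      by (rule lborel_integrable_real_affine[OF J_exp_moments[OF 3]]) simp
    then show ?thesis using J_even by simp
  qed (use J_exp_moments J_integrable in auto)
qed

lemma moment_even: "moment (- a) = moment a"
  unfolding moment_def
  by (subst lborel_integral_real_affine[where c = "-1" and t = 0]) (simp_all flip: J_even)

lemma moment_nonneg: "moment a \<ge> 0"
  unfolding moment_def by (rule Bochner_Integration.integral_nonneg) (simp add: J_nonneg)

text \<open>
  Evenness of \<open>J\<close> removes the term of first order: twice the excess of the moment over \<open>1\<close> is the integral of
  \<open>J w * (exp (a w) + exp (- a w) - 2)\<close>, whose second factor is of order \<open>a\<^sup>2\<close>.
\<close>

lemma moment_quadratic_bound:
  assumes a: "0 < a" "a \<le> 1" shows "moment a \<le> 1 + 2 * a\<^sup>2 * moment 2"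
proof -
  have "moment a + moment (- a) - 2 * 1
      = (\<integral>w. J w * exp (a * w) + J w * exp (- a * w) - 2 * J w \<partial>lborel)"
    unfolding moment_def J_integral[symmetric]
    by (simp add: moment_integrable moment_integrable[of "- a", simplified] J_integrable)
  also have "\<dots> \<le> (\<integral>w. 2 * a\<^sup>2 * (J w * exp (2 * w) + J w * exp (- 2 * w)) \<partial>lborel)"
  proof (rule integral_mono)
    fix w
    have "exp (a * w) + exp (- (a * w)) - 2 \<le> (a * w)\<^sup>2 * exp \<bar>a * w\<bar>"
      by (rule exp_plus_exp_minus_le)
    also have "\<dots> \<le> (a\<^sup>2 * (2 * exp \<bar>w\<bar>)) * exp \<bar>w\<bar>"
    proof (rule mult_mono)
      show "(a * w)\<^sup>2 \<le> a\<^sup>2 * (2 * exp \<bar>w\<bar>)"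
        unfolding power_mult_distrib by (rule mult_left_mono[OF square_le_exp_abs]) simp
      have "a * \<bar>w\<bar> \<le> 1 * \<bar>w\<bar>" by (rule mult_right_mono) (use a in auto)
      then show "exp \<bar>a * w\<bar> \<le> exp \<bar>w\<bar>" using a by (simp add: abs_mult)
    qed auto
    also have "\<dots> = 2 * a\<^sup>2 * exp (2 * \<bar>w\<bar>)" by (simp add: exp_double power2_eq_square)
    also have "\<dots> \<le> 2 * a\<^sup>2 * (exp (2 * w) + exp (- 2 * w))"
      by (intro mult_left_mono) (auto simp: abs_if)
    finally have "J w * (exp (a * w) + exp (- (a * w)) - 2)
        \<le> J w * (2 * a\<^sup>2 * (exp (2 * w) + exp (- 2 * w)))"
      by (rule mult_left_mono) (rule J_nonneg)
    then show "J w * exp (a * w) + J w * exp (- a * w) - 2 * J w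
        \<le> 2 * a\<^sup>2 * (J w * exp (2 * w) + J w * exp (- 2 * w))"
      by (simp add: algebra_simps)
  qed (use moment_integrable moment_integrable[of "- a", simplified]
        moment_integrable[of "- 2", simplified] J_integrable in auto)
  also have "\<dots> = 2 * a\<^sup>2 * (moment 2 + moment (- 2))"
    unfolding moment_def
    by (simp add: moment_integrable moment_integrable[of "- 2", simplified])
  finally show ?thesis by (simp add: moment_even algebra_simps)
qed

text \<open>
  On a pure exponential \<open>exp (- \<alpha> z)\<close> convolution acts as multiplication by \<open>moment \<alpha>\<close>.  The points where \<open>G\<close> is not
  exponential are reached only by jumps \<open>w > R\<close>, and for those \<open>1 \<le> exp (w - R)\<close> trades the bound \<open>G \<le> 1\<close> for a
  higher moment with a factor that is small for large \<open>R\<close>.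
\<close>

lemma conv_exponential_tail:
  assumes G: "G \<in> BC" "\<And>z. G z \<le> 1"
    and tail: "\<And>z. z \<ge> b + 1 \<Longrightarrow> G z = exp (- \<alpha> * (z - b))"
    and \<alpha>: "\<alpha> \<ge> 0" and R: "R \<ge> 0" "z \<ge> b + 1 + R"
  shows "conv J G z \<le> G z * (moment \<alpha> + exp (\<alpha> - R) * moment (\<alpha> + 1))"
proof -
  have Gz: "G z = exp (- \<alpha> * (z - b))" by (rule tail) (use R in simp)
  have pointwise: "G (z - w) \<le> G z * (exp (\<alpha> * w) + exp (\<alpha> - R) * exp ((\<alpha> + 1) * w))" for w
  proof (cases "z - w \<ge> b + 1")
    case True
    have "G (z - w) = G z * exp (\<alpha> * w)"
      unfolding Gz tail[OF True] by (simp add: algebra_simps flip: exp_add)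
    then show ?thesis using Gz by (simp add: distrib_left)
  next
    case False
    have "0 \<le> \<alpha> * (w - (z - b - 1)) + (w - R)"
      using False \<alpha> R(2) by (intro add_nonneg_nonneg mult_nonneg_nonneg) auto
    then have "1 \<le> exp (\<alpha> * (w - (z - b - 1)) + (w - R))" by simp
    also have "\<dots> = G z * (exp (\<alpha> - R) * exp ((\<alpha> + 1) * w))"
      unfolding Gz by (simp add: algebra_simps flip: exp_add)
    also have "\<dots> \<le> G z * (exp (\<alpha> * w) + exp (\<alpha> - R) * exp ((\<alpha> + 1) * w))"
      unfolding Gz by (simp add: distrib_left)
    finally show ?thesis using G(2)[of "z - w"] by linarith
  qed
  have "conv J G z \<le> (\<integral>w. G z * (J w * exp (\<alpha> * w))
      + G z * exp (\<alpha> - R) * (J w * exp ((\<alpha> + 1) * w)) \<partial>lborel)"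
    unfolding conv_eq
  proof (rule integral_mono)
    show "integrable lborel (\<lambda>w. G z * (J w * exp (\<alpha> * w))
        + G z * exp (\<alpha> - R) * (J w * exp ((\<alpha> + 1) * w)))"
      using moment_integrable by (intro Bochner_Integration.integrable_add integrable_mult_right) auto
    fix w
    show "J w * G (z - w) \<le> G z * (J w * exp (\<alpha> * w))
        + G z * exp (\<alpha> - R) * (J w * exp ((\<alpha> + 1) * w))"
      using mult_left_mono[OF pointwise[of w] J_nonneg[of w]] by (simp add: algebra_simps)
  qed (rule conv_integrable[OF G(1)])
  also have "\<dots> = G z * moment \<alpha> + G z * exp (\<alpha> - R) * moment (\<alpha> + 1)"
    unfolding moment_def using moment_integrable
    by (subst Bochner_Integration.integral_add) auto
  finally show ?thesis by (simp add: algebra_simps)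
qed

end

lemma weight_familyD:
  assumes "weight_family M\<^sub>1 \<Gamma>" "\<alpha> > 0"
  shows "0 \<le> \<Gamma> \<alpha> z" "\<Gamma> \<alpha> z \<le> 1" "antimono (\<Gamma> \<alpha>)" "z \<le> - M\<^sub>1 - 1 \<Longrightarrow> \<Gamma> \<alpha> z = 1"
    "z \<ge> M\<^sub>1 + 1 \<Longrightarrow> \<Gamma> \<alpha> z = exp (- \<alpha> * (z - M\<^sub>1))"
    "(\<Gamma> \<alpha> has_real_derivative deriv (\<Gamma> \<alpha>) z) (at z)"
    "deriv (\<Gamma> \<alpha>) z \<le> 0"
    "z > M\<^sub>1 + 1 \<Longrightarrow> deriv (\<Gamma> \<alpha>) z = - \<alpha> * \<Gamma> \<alpha> z"
    "\<Gamma> \<alpha> \<in> BC"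
proof -
  have W: "range (\<Gamma> \<alpha>) \<subseteq> {0..1}" "smooth (\<Gamma> \<alpha>)" "antimono (\<Gamma> \<alpha>)"
    "\<And>z. z \<le> - M\<^sub>1 - 1 \<Longrightarrow> \<Gamma> \<alpha> z = 1"
    "\<And>z. z \<ge> M\<^sub>1 + 1 \<Longrightarrow> \<Gamma> \<alpha> z = exp (- \<alpha> * (z - M\<^sub>1))"
    using assms unfolding weight_family_def by blast+
  show range: "0 \<le> \<Gamma> \<alpha> z" "\<Gamma> \<alpha> z \<le> 1" for z
    using W(1) by (auto simp: image_subset_iff)
  show "antimono (\<Gamma> \<alpha>)" by (rule W)
  show "\<Gamma> \<alpha> z = 1" if "z \<le> - M\<^sub>1 - 1" using W that by blast
  show "\<Gamma> \<alpha> z = exp (- \<alpha> * (z - M\<^sub>1))" if "z \<ge> M\<^sub>1 + 1" using W that by blast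
  show deriv: "(\<Gamma> \<alpha> has_real_derivative deriv (\<Gamma> \<alpha>) z) (at z)" for z
    using W(2)[unfolded smooth_def, rule_format, of 0 z]
    by (simp add: DERIV_deriv_iff_field_differentiable)
  have "((\<lambda>z. - \<Gamma> \<alpha> z) has_real_derivative - deriv (\<Gamma> \<alpha>) z) (at z)"
    by (intro derivative_intros deriv)
  then have "- deriv (\<Gamma> \<alpha>) z \<ge> 0"
    by (rule mono_on_imp_deriv_nonneg[of UNIV, rotated])
       (use W(3) in \<open>auto simp: monotone_on_def dest: antimonoD\<close>)
  then show "deriv (\<Gamma> \<alpha>) z \<le> 0" by simp
  show "deriv (\<Gamma> \<alpha>) z = - \<alpha> * \<Gamma> \<alpha> z" if "z > M\<^sub>1 + 1"
  proof (rule DERIV_unique[OF deriv])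
    have "((\<lambda>z. exp (- \<alpha> * (z - M\<^sub>1))) has_real_derivative - \<alpha> * exp (- \<alpha> * (z - M\<^sub>1))) (at z)"
      by (auto intro!: derivative_eq_intros)
    then have "(\<Gamma> \<alpha> has_real_derivative - \<alpha> * exp (- \<alpha> * (z - M\<^sub>1))) (at z)"
      by (rule has_field_derivative_transform_within_open[of _ _ _ "{M\<^sub>1 + 1<..}"])
         (use W(5) that in auto)
    then show "(\<Gamma> \<alpha> has_real_derivative - \<alpha> * \<Gamma> \<alpha> z) (at z)"
      using W(5)[of z] that by simp
  qed
  show "\<Gamma> \<alpha> \<in> BC"
    by (rule BC_I[of _ 1]) (use range DERIV_isCont[OF deriv] in \<open>auto simp: continuous_on_eq_continuous_at\<close>)
qed

context limiting_front begin

text \<open>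
  The differential inequality behind both the super- and the subsolution, by cases on the three regions.  The bound
  \<open>A q \<le> c_min / 2\<close> is for \<open>\<sigma> = - 1\<close>, where the shift moves against the front and would otherwise
  spoil the transport term; it leaves the relative speed \<open>Y\<close> at least \<open>c_min / 2\<close>.
\<close>

lemma barrier:
  assumes \<sigma>: "\<sigma> = 1 \<or> \<sigma> = - 1"
    and cutoff: "cutoff_width u X \<theta> \<theta>\<^sub>1 M\<^sub>1" and weight: "weight_family M\<^sub>1 \<Gamma>" and \<alpha>: "\<alpha> > 0"
    and K: "K > 0" "\<And>t a b. \<bar>f t a - f t b\<bar> \<le> K * \<bar>a - b\<bar>"
    and M: "M \<ge> M\<^sub>1 + 1" "\<And>z. z \<ge> M \<Longrightarrow> conv J (\<Gamma> \<alpha>) z \<le> (1 + \<alpha> * c_min / 4) * \<Gamma> \<alpha> z"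
    and \<omega>: "\<omega> > 0" "\<omega> \<le> \<beta>\<^sub>1" "\<omega> \<le> \<alpha> * c_min / 4"
    and A: "A > 0" "\<delta> * A \<ge> \<omega> + K + 1"
    and q: "0 \<le> q" "q \<le> 1" "q \<le> (1 - \<theta>\<^sub>1) / 2" "q \<le> \<theta> / 2" "A * q \<le> c_min / 2"
  shows "\<sigma> * (f t (u t (X t + z) + \<sigma> * (q * \<Gamma> \<alpha> z)) - f t (u t (X t + z)))
        + q * (conv J (\<Gamma> \<alpha>) z - \<Gamma> \<alpha> z)
      \<le> (if \<bar>z\<bar> \<le> M then \<delta> else 0) * (A * q) - \<omega> * q * \<Gamma> \<alpha> z
        - q * deriv (\<Gamma> \<alpha>) z * (deriv X t + \<sigma> * (A * q))"
proof -
  note G = weight_familyD[OF weight \<alpha>]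
  define g where "g = \<Gamma> \<alpha> z"
  define U where "U = u t (X t + z)"
  define Y where "Y = deriv X t + \<sigma> * (A * q)"
  define P where "P = q * (- deriv (\<Gamma> \<alpha>) z) * Y"
  have g: "0 \<le> g" "g \<le> 1" unfolding g_def using G by auto
  have qg: "0 \<le> q * g" "q * g \<le> q" using g q(1) by (auto intro: mult_left_le)
  have cutoff': "z \<le> - M\<^sub>1 \<Longrightarrow> U \<ge> (1 + \<theta>\<^sub>1) / 2" "z \<ge> M\<^sub>1 \<Longrightarrow> U \<le> \<theta> / 2" "M\<^sub>1 > 0"
    using cutoff by (auto simp: cutoff_width_def U_def)
  have Aq: "A * q \<ge> 0" using A(1) q(1) by simp
  have Y: "Y \<ge> c_min / 2"
    using X_speed[of t] q(5) Aq \<sigma> by (auto simp: Y_def)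
  have P: "P \<ge> 0" unfolding P_def
    using q(1) G(7) Y constants_pos(1) by (intro mult_nonneg_nonneg) auto
  have conv_le: "conv J (\<Gamma> \<alpha>) z \<le> 1"
    using conv_mono[OF G(9) BC_const[of 1] G(2), of z] by (simp add: conv_const)
  have qconv: "q * (conv J (\<Gamma> \<alpha>) z - g) \<le> q * (1 - g)"
    using conv_le q(1) by (intro mult_left_mono) auto
  have "\<sigma> * (f t (U + \<sigma> * (q * g)) - f t U) + q * (conv J (\<Gamma> \<alpha>) z - g)
      \<le> (if \<bar>z\<bar> \<le> M then \<delta> else 0) * (A * q) - \<omega> * q * g + P"
  proof -
    consider "\<bar>z\<bar> \<le> M" | "z > M" | "z < - M" by linarith
    then show ?thesis
    proof cases
      case 1
      have "\<bar>f t (U + \<sigma> * (q * g)) - f t U\<bar> \<le> K * (q * g)"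
        using K(2)[of t "U + \<sigma> * (q * g)" U] \<sigma> qg(1) by auto
      then have "\<sigma> * (f t (U + \<sigma> * (q * g)) - f t U) \<le> K * (q * g)" using \<sigma> by auto
      also have "\<dots> \<le> K * q" using qg K(1) by simp
      finally have reaction: "\<sigma> * (f t (U + \<sigma> * (q * g)) - f t U) \<le> K * q" .
      have "(\<omega> + K + 1) * q \<le> \<delta> * A * q" by (rule mult_right_mono) (use A q in auto)
      moreover have "\<omega> * (q * g) \<le> \<omega> * q" using qg \<omega> by simp
      ultimately show ?thesis using 1 reaction qconv qg(1) P by (simp add: algebra_simps)
    next
      case 2
      have "U + \<sigma> * (q * g) \<le> \<theta>" "U \<le> \<theta>"
        using cutoff'(2,3) 2 M(1) qg q(4) \<sigma> \<theta> by auto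
      then have reaction: "\<sigma> * (f t (U + \<sigma> * (q * g)) - f t U) = 0"
        by (simp add: f_ignition_zero)
      have "q * (conv J (\<Gamma> \<alpha>) z - g) \<le> q * (\<alpha> * c_min / 4 * g)"
        using M(2)[of z] 2 q(1) by (intro mult_left_mono) (auto simp: g_def algebra_simps)
      moreover have "P = q * g * \<alpha> * Y" using G(8)[of z] 2 M(1) by (simp add: P_def g_def)
      moreover have "q * g * \<alpha> * (c_min / 2) \<le> q * g * \<alpha> * Y"
        by (rule mult_left_mono[OF Y]) (use qg \<alpha> in simp)
      moreover have "\<omega> * (q * g) \<le> \<alpha> * c_min / 4 * (q * g)"
        by (rule mult_right_mono) (use \<omega> qg in auto)
      ultimately show ?thesis
        unfolding reaction using 2 cutoff'(3) M(1) by (simp add: algebra_simps)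
    next
      case 3
      have U: "U \<ge> (1 + \<theta>\<^sub>1) / 2" "U \<le> 1"
        using cutoff'(1) 3 M(1) u_range by (auto simp: U_def)
      have g1: "g = 1" using G(4)[of z] 3 M(1) by (simp add: g_def)
      have "\<sigma> * (f t (U + \<sigma> * q) - f t U) \<le> - \<beta>\<^sub>1 * q"
      proof (cases "\<sigma> = 1")
        case True
        have "f t (U + q) - f t U \<le> - \<beta>\<^sub>1 * (U + q - U)"
          by (rule f_decreasing_near_1) (use U q \<theta>\<^sub>1 in \<open>auto simp: field_simps\<close>)
        then show ?thesis using True by simp
      next
        case False
        have "f t U - f t (U - q) \<le> - \<beta>\<^sub>1 * (U - (U - q))"
          by (rule f_decreasing_near_1) (use U q in \<open>auto simp: field_simps\<close>)
        then show ?thesis using False \<sigma> by simp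
      qed
      moreover have "\<omega> * q \<le> \<beta>\<^sub>1 * q" by (rule mult_right_mono) (use \<omega> q in auto)
      ultimately show ?thesis using 3 qconv P M(1) cutoff'(3) by (simp add: g1)
    qed
  qed
  then show ?thesis by (simp add: g_def U_def P_def Y_def algebra_simps)
qed

end

section \<open>Local stability\<close>

context limiting_front begin

text \<open>
  One half of the sandwich: \<open>\<sigma> = 1\<close> is the bound from above and \<open>\<sigma> = - 1\<close> the one from below.
\<close>

definition one_sided_trapping :: "(real \<Rightarrow> real) \<Rightarrow> real \<Rightarrow> real \<Rightarrow> real \<Rightarrow> bool" where
  "one_sided_trapping G \<epsilon>\<^sub>0 \<omega> A \<longleftrightarrow> (\<forall>\<sigma> v t\<^sub>0 \<epsilon> \<zeta> t x.
    (\<sigma> = 1 \<or> \<sigma> = - 1) \<longrightarrow> solves_on J f {t\<^sub>0..} v \<longrightarrow> 0 < \<epsilon> \<longrightarrow> \<epsilon> \<le> \<epsilon>\<^sub>0 \<longrightarrow>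
    (\<forall>x. \<sigma> * (u t\<^sub>0 (x - \<zeta>) - v t\<^sub>0 x) + \<epsilon> * G (x - \<zeta> - X t\<^sub>0) \<ge> 0) \<longrightarrow> t\<^sub>0 \<le> t \<longrightarrow>
    (let \<eta> = \<zeta> + \<sigma> * (A * \<epsilon> / \<omega> * (1 - exp (- \<omega> * (t - t\<^sub>0)))) in
      \<sigma> * (u t (x - \<eta>) - v t x) + \<epsilon> * exp (- \<omega> * (t - t\<^sub>0)) * G (x - \<eta> - X t) \<ge> 0))"

lemma one_sided_trappingD:
  assumes trap: "one_sided_trapping G \<epsilon>\<^sub>0 \<omega> A" and v: "solves_on J f {t\<^sub>0..} v"
    and \<epsilon>: "0 < \<epsilon>" "\<epsilon> \<le> \<epsilon>\<^sub>0" and t: "t\<^sub>0 \<le> t"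
  defines "e \<equiv> A * \<epsilon> / \<omega> * (1 - exp (- \<omega> * (t - t\<^sub>0)))"
  shows "(\<And>x. v t\<^sub>0 x \<le> u t\<^sub>0 (x - \<zeta>) + \<epsilon> * G (x - \<zeta> - X t\<^sub>0)) \<Longrightarrow>
      v t x \<le> u t (x - (\<zeta> + e)) + \<epsilon> * exp (- \<omega> * (t - t\<^sub>0)) * G (x - (\<zeta> + e) - X t)"
    and "(\<And>x. u t\<^sub>0 (x - \<zeta>) - \<epsilon> * G (x - \<zeta> - X t\<^sub>0) \<le> v t\<^sub>0 x) \<Longrightarrow>
      u t (x - (\<zeta> - e)) - \<epsilon> * exp (- \<omega> * (t - t\<^sub>0)) * G (x - (\<zeta> - e) - X t) \<le> v t x"
proof -
  define r where "r = \<epsilon> * exp (- \<omega> * (t - t\<^sub>0))"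
  have main: "\<sigma> * (u t (x - (\<zeta> + \<sigma> * e)) - v t x) + r * G (x - (\<zeta> + \<sigma> * e) - X t) \<ge> 0"
    if "\<sigma> = 1 \<or> \<sigma> = - 1"
      "\<forall>x. \<sigma> * (u t\<^sub>0 (x - \<zeta>) - v t\<^sub>0 x) + \<epsilon> * G (x - \<zeta> - X t\<^sub>0) \<ge> 0" for \<sigma>
    using trap[unfolded one_sided_trapping_def Let_def, rule_format, OF that(1) v \<epsilon> _ t]
      that(2) unfolding e_def r_def by blast
  show "v t x \<le> u t (x - (\<zeta> + e)) + \<epsilon> * exp (- \<omega> * (t - t\<^sub>0)) * G (x - (\<zeta> + e) - X t)"
    if "\<And>x. v t\<^sub>0 x \<le> u t\<^sub>0 (x - \<zeta>) + \<epsilon> * G (x - \<zeta> - X t\<^sub>0)"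
  proof -
    have "\<forall>x. 1 * (u t\<^sub>0 (x - \<zeta>) - v t\<^sub>0 x) + \<epsilon> * G (x - \<zeta> - X t\<^sub>0) \<ge> 0"
      using that by (simp add: algebra_simps)
    from main[OF _ this] show ?thesis by (simp add: r_def)
  qed
  show "u t (x - (\<zeta> - e)) - \<epsilon> * exp (- \<omega> * (t - t\<^sub>0)) * G (x - (\<zeta> - e) - X t) \<le> v t x"
    if "\<And>x. u t\<^sub>0 (x - \<zeta>) - \<epsilon> * G (x - \<zeta> - X t\<^sub>0) \<le> v t\<^sub>0 x"
  proof -
    have "\<forall>x. - 1 * (u t\<^sub>0 (x - \<zeta>) - v t\<^sub>0 x) + \<epsilon> * G (x - \<zeta> - X t\<^sub>0) \<ge> 0"
      using that by (simp add: algebra_simps)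
    from main[OF _ this] show ?thesis by (simp add: r_def)
  qed
qed

text \<open>
  The constants are chosen in the order \<open>\<alpha>\<close>, then the right end \<open>M\<close> of the interface (so that ahead of it dispersal costs
  at most \<open>\<alpha> c_min / 4\<close>), then the steepness \<open>\<delta>\<close> on the interface, the rate \<open>\<omega>\<close>, the shift speed \<open>A\<close>, and finally
  \<open>\<epsilon>\<^sub>0\<close>, which keeps the perturbed front where the structure of \<open>f\<close> is known.
\<close>

lemma one_sided_stability:
  assumes cutoff: "cutoff_width u X \<theta> \<theta>\<^sub>1 M\<^sub>1" and weight: "weight_family M\<^sub>1 \<Gamma>"
  obtains \<alpha>\<^sub>0 where "\<alpha>\<^sub>0 > 0"
    "\<And>\<alpha>. 0 < \<alpha> \<Longrightarrow> \<alpha> \<le> \<alpha>\<^sub>0 \<Longrightarrow>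
      \<exists>\<epsilon>\<^sub>0>0. \<exists>\<omega>>0. \<exists>A>0. one_sided_trapping (\<Gamma> \<alpha>) \<epsilon>\<^sub>0 \<omega> A"
proof -
  obtain K where K: "K > 0" "\<And>t a b. \<bar>f t a - f t b\<bar> \<le> K * \<bar>a - b\<bar>"
    using f_Lipschitz by blast
  define \<alpha>\<^sub>0 where "\<alpha>\<^sub>0 = min 1 (c_min / (16 * (moment 2 + 1)))"
  note c_min = constants_pos(1)
  show thesis
  proof (rule that[of \<alpha>\<^sub>0])
    show "\<alpha>\<^sub>0 > 0" using c_min moment_nonneg[of 2] by (simp add: \<alpha>\<^sub>0_def)
    fix \<alpha> assume \<alpha>: "0 < \<alpha>" "\<alpha> \<le> \<alpha>\<^sub>0"
    note G = weight_familyD[OF weight \<alpha>(1)]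
    have "\<alpha> * (16 * (moment 2 + 1)) \<le> c_min"
      using \<alpha>(2) moment_nonneg[of 2] by (simp add: \<alpha>\<^sub>0_def field_simps)
    then have "\<alpha> * (\<alpha> * (16 * (moment 2 + 1))) \<le> \<alpha> * c_min"
      using \<alpha>(1) by (intro mult_left_mono) auto
    then have "2 * \<alpha>\<^sup>2 * moment 2 + 2 * \<alpha>\<^sup>2 \<le> \<alpha> * c_min / 8"
      by (simp add: power2_eq_square algebra_simps)
    then have m1: "moment \<alpha> \<le> 1 + \<alpha> * c_min / 8"
      using moment_quadratic_bound[of \<alpha>] \<alpha> zero_le_power2[of \<alpha>] unfolding \<alpha>\<^sub>0_def by linarith
    \<comment> \<open>Any \<open>R\<close> with \<open>exp R\<close> above this value makes the jump term small, and \<open>R < exp R\<close>.\<close>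
    define R where "R = 8 * exp \<alpha> * moment (\<alpha> + 1) / (\<alpha> * c_min)"
    have R: "R \<ge> 0" "exp (\<alpha> - R) * moment (\<alpha> + 1) < \<alpha> * c_min / 8"
    proof -
      have pos: "\<alpha> * c_min > 0" using \<alpha> c_min by simp
      show "R \<ge> 0" unfolding R_def using pos moment_nonneg[of "\<alpha> + 1"] by simp
      have "R < exp R" using exp_ge_add_one_self[of R] by linarith
      then have "8 * exp \<alpha> * moment (\<alpha> + 1) < exp R * (\<alpha> * c_min)"
        using pos by (simp add: R_def pos_divide_less_eq)
      then show "exp (\<alpha> - R) * moment (\<alpha> + 1) < \<alpha> * c_min / 8"
        by (simp add: exp_diff divide_simps mult_ac)
    qed
    define M where "M = M\<^sub>1 + 1 + R"
    have M: "M \<ge> M\<^sub>1 + 1" using R by (simp add: M_def)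
    have far: "conv J (\<Gamma> \<alpha>) z \<le> (1 + \<alpha> * c_min / 4) * \<Gamma> \<alpha> z" if "z \<ge> M" for z
    proof -
      have "conv J (\<Gamma> \<alpha>) z \<le> \<Gamma> \<alpha> z * (moment \<alpha> + exp (\<alpha> - R) * moment (\<alpha> + 1))"
        by (rule conv_exponential_tail[OF G(9,2,5) _ R(1)]) (use \<alpha> that in \<open>auto simp: M_def\<close>)
      also have "\<dots> \<le> \<Gamma> \<alpha> z * (1 + \<alpha> * c_min / 4)"
        by (rule mult_left_mono) (use m1 R(2) G(1) in auto)
      finally show ?thesis by (simp add: mult.commute)
    qed
    obtain \<delta> h\<^sub>0 where steep: "\<delta> > 0" "h\<^sub>0 > 0"
      "\<And>t x h. \<bar>x - X t\<bar> \<le> M + 1 \<Longrightarrow> 0 \<le> h \<Longrightarrow> h \<le> h\<^sub>0 \<Longrightarrow> u t x - u t (x + h) \<ge> \<delta> * h"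
      using steepness[OF cutoff, of "M + 1"] by blast
    define \<omega> where "\<omega> = min \<beta>\<^sub>1 (\<alpha> * c_min / 4)"
    have \<omega>: "\<omega> > 0" "\<omega> \<le> \<beta>\<^sub>1" "\<omega> \<le> \<alpha> * c_min / 4"
      using \<beta>\<^sub>1 \<alpha>(1) c_min by (auto simp: \<omega>_def)
    define A where "A = (\<omega> + K + 1) / \<delta>"
    have A: "A > 0" "\<delta> * A \<ge> \<omega> + K + 1"
      using \<omega>(1) K(1) steep(1) by (auto simp: A_def)
    define \<epsilon>\<^sub>0 where "\<epsilon>\<^sub>0 = Min {1, (1 - \<theta>\<^sub>1) / 2, \<theta> / 2, c_min / (2 * A)}"
    have "\<epsilon>\<^sub>0 > 0"
      unfolding \<epsilon>\<^sub>0_def by (subst Min_gr_iff) (use \<theta> \<theta>\<^sub>1 c_min A(1) in auto)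
    moreover have "\<epsilon>\<^sub>0 \<le> 1" "\<epsilon>\<^sub>0 \<le> (1 - \<theta>\<^sub>1) / 2" "\<epsilon>\<^sub>0 \<le> \<theta> / 2" "\<epsilon>\<^sub>0 \<le> c_min / (2 * A)"
      unfolding \<epsilon>\<^sub>0_def by (rule Min_le; simp)+
    ultimately have \<epsilon>\<^sub>0: "\<epsilon>\<^sub>0 > 0" "\<epsilon>\<^sub>0 \<le> 1" "\<epsilon>\<^sub>0 \<le> (1 - \<theta>\<^sub>1) / 2" "\<epsilon>\<^sub>0 \<le> \<theta> / 2"
      "\<epsilon>\<^sub>0 \<le> c_min / (2 * A)" .
    have "one_sided_trapping (\<Gamma> \<alpha>) \<epsilon>\<^sub>0 \<omega> A"
      unfolding one_sided_trapping_def
    proof (intro allI impI)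
      fix \<sigma> v t\<^sub>0 \<epsilon> \<zeta> t x
      assume \<sigma>: "\<sigma> = 1 \<or> \<sigma> = - 1" and v: "solves_on J f {t\<^sub>0..} v"
        and \<epsilon>: "0 < \<epsilon>" "\<epsilon> \<le> \<epsilon>\<^sub>0" and t: "t\<^sub>0 \<le> t"
        and init: "\<forall>x. \<sigma> * (u t\<^sub>0 (x - \<zeta>) - v t\<^sub>0 x) + \<epsilon> * \<Gamma> \<alpha> (x - \<zeta> - X t\<^sub>0) \<ge> 0"
      define \<rho> where "\<rho> = (\<lambda>t. A * \<epsilon> / \<omega> * (1 - exp (- \<omega> * (t - t\<^sub>0))))"
      define q where "q = (\<lambda>t. \<epsilon> * exp (- \<omega> * (t - t\<^sub>0)))"
      have q: "0 \<le> q s" "q s \<le> \<epsilon>" if "s \<ge> t\<^sub>0" for s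
        using that \<omega>(1) \<epsilon>(1) by (auto simp: q_def)
      have "\<sigma> * (u t (x - (\<zeta> + \<sigma> * \<rho> t)) - v t x) + q t * \<Gamma> \<alpha> (x - (\<zeta> + \<sigma> * \<rho> t) - X t) \<ge> 0"
      proof (rule shifted_front_comparison[OF \<sigma> K G(1,2,6) _ _ _ _ steep(2,3) _ v _ t])
        show "(\<rho> has_real_derivative A * q t) (at t)" for t
          unfolding \<rho>_def q_def using \<omega>(1) by (auto intro!: derivative_eq_intros)
        show "(q has_real_derivative - \<omega> * q t) (at t)" for t
          unfolding q_def by (auto intro!: derivative_eq_intros)
        show "mono \<rho>"
          unfolding \<rho>_def using A(1) \<epsilon>(1) \<omega>(1)
          by (intro monoI mult_left_mono) (auto intro!: mult_left_mono)
        show "0 \<le> q s" if "s \<ge> t\<^sub>0" for s by (rule q(1)[OF that])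
        show "\<sigma> * (f s (u s (X s + z) + \<sigma> * (q s * \<Gamma> \<alpha> z)) - f s (u s (X s + z)))
            + q s * (conv J (\<Gamma> \<alpha>) z - \<Gamma> \<alpha> z)
          \<le> (if \<bar>z\<bar> \<le> M then \<delta> else 0) * (A * q s) - \<omega> * q s * \<Gamma> \<alpha> z
            - q s * deriv (\<Gamma> \<alpha>) z * (deriv X s + \<sigma> * (A * q s))" if s: "s \<ge> t\<^sub>0" for s z
        proof (rule barrier[OF \<sigma> cutoff weight \<alpha>(1) K M far \<omega> A])
          have "A * q s \<le> A * (c_min / (2 * A))"
            by (rule mult_left_mono) (use q(2)[OF s] \<epsilon>(2) \<epsilon>\<^sub>0(5) A(1) in auto)
          then show "A * q s \<le> c_min / 2" using A(1) by simp
        qed (use q[OF s] \<epsilon>(2) \<epsilon>\<^sub>0 in auto)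
        show "\<sigma> * (u t\<^sub>0 (x - (\<zeta> + \<sigma> * \<rho> t\<^sub>0)) - v t\<^sub>0 x)
            + q t\<^sub>0 * \<Gamma> \<alpha> (x - (\<zeta> + \<sigma> * \<rho> t\<^sub>0) - X t\<^sub>0) \<ge> 0" for x
          using init by (simp add: \<rho>_def q_def)
      qed
      then show "let \<eta> = \<zeta> + \<sigma> * (A * \<epsilon> / \<omega> * (1 - exp (- \<omega> * (t - t\<^sub>0)))) in
        0 \<le> \<sigma> * (u t (x - \<eta>) - v t x) + \<epsilon> * exp (- \<omega> * (t - t\<^sub>0)) * \<Gamma> \<alpha> (x - \<eta> - X t)"
        unfolding Let_def \<rho>_def q_def .
    qed
    then show "\<exists>\<epsilon>\<^sub>0>0. \<exists>\<omega>>0. \<exists>A>0. one_sided_trapping (\<Gamma> \<alpha>) \<epsilon>\<^sub>0 \<omega> A"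
      using \<epsilon>\<^sub>0(1) \<omega>(1) A(1) by blast
  qed
qed

end

section \<open>Initial data exponentially close to the front\<close>

context limiting_front begin

text \<open>
  Far to the left the front itself, together with the weight \<open>1\<close>, exceeds \<open>1\<close>.  Elsewhere the deviation
  \<open>C exp (- \<beta>\<^sub>0 (x - X))\<close> is dominated by the weight, since \<open>\<alpha> \<le> \<beta>\<^sub>0\<close> and a shift by \<open>d\<close> beyond \<open>L\<close> gains the
  factor \<open>exp (- \<beta>\<^sub>0 d)\<close>.
\<close>

lemma front_shifted_right_dominates:
  assumes cutoff: "cutoff_width u X \<theta> \<theta>\<^sub>1 M\<^sub>1" and weight: "weight_family M\<^sub>1 \<Gamma>"
    and \<alpha>: "0 < \<alpha>" "\<alpha> \<le> \<beta>\<^sub>0" and \<epsilon>: "\<epsilon> > 0" and C: "C > 0"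
    and u\<^sub>0: "\<And>x. u\<^sub>0 x \<le> 1" "\<And>x. u\<^sub>0 x \<le> u t\<^sub>0 x + C * exp (- \<beta>\<^sub>0 * (x - X t\<^sub>0))"
  obtains \<zeta> where "\<And>x. u\<^sub>0 x \<le> u t\<^sub>0 (x - \<zeta>) + \<epsilon> * \<Gamma> \<alpha> (x - \<zeta> - X t\<^sub>0)"
proof -
  note G = weight_familyD[OF weight \<alpha>(1)]
  have M1: "M\<^sub>1 > 0" using cutoff by (simp add: cutoff_width_def)
  have "\<forall>\<^sub>F x in at_bot. 1 - \<epsilon> < u t\<^sub>0 x"
    by (rule order_tendstoD[OF u_limits(1)]) (use \<epsilon> in simp)
  then obtain N where N: "\<And>x. x \<le> N \<Longrightarrow> 1 - \<epsilon> < u t\<^sub>0 x"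
    by (auto simp: eventually_at_bot_linorder)
  define L where "L = max (M\<^sub>1 + 1) (X t\<^sub>0 - N)"
  have L: "L \<ge> M\<^sub>1 + 1" "X t\<^sub>0 - L \<le> N" by (auto simp: L_def)
  define d where "d = max 0 (ln (C * exp \<alpha> / \<epsilon>) / \<beta>\<^sub>0)"
  have \<beta>\<^sub>0: "\<beta>\<^sub>0 > 0" using \<alpha> by simp
  have "ln (C * exp \<alpha> / \<epsilon>) / \<beta>\<^sub>0 \<le> d" by (simp add: d_def)
  then have "ln (C * exp \<alpha> / \<epsilon>) \<le> \<beta>\<^sub>0 * d" using \<beta>\<^sub>0 by (simp add: field_simps)
  then have "exp (ln (C * exp \<alpha> / \<epsilon>)) \<le> exp (\<beta>\<^sub>0 * d)" by simp
  then have "C * exp \<alpha> \<le> \<epsilon> * exp (\<beta>\<^sub>0 * d)" using C \<epsilon> by (simp add: field_simps)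
  then have "(C * exp \<alpha>) * (exp (- \<alpha>) * exp (- (\<beta>\<^sub>0 * d)))
      \<le> (\<epsilon> * exp (\<beta>\<^sub>0 * d)) * (exp (- \<alpha>) * exp (- (\<beta>\<^sub>0 * d)))"
    by (rule mult_right_mono) simp
  then have d: "C * exp (- \<beta>\<^sub>0 * d) \<le> \<epsilon> * exp (- \<alpha>)"
    by (simp add: exp_minus field_simps)
  have d0: "d \<ge> 0" by (simp add: d_def)
  show thesis
  proof (rule that[of "L + d"])
    fix x
    define z where "z = x - (L + d) - X t\<^sub>0"
    show "u\<^sub>0 x \<le> u t\<^sub>0 (x - (L + d)) + \<epsilon> * \<Gamma> \<alpha> (x - (L + d) - X t\<^sub>0)"
    proof (cases "z \<le> - L")
      case True
      then have "x - (L + d) \<le> N" using L(2) by (simp add: z_def)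
      then have "1 - \<epsilon> < u t\<^sub>0 (x - (L + d))" by (rule N)
      moreover have "\<Gamma> \<alpha> z = 1" by (rule G(4)) (use True L in simp)
      ultimately show ?thesis using u\<^sub>0(1)[of x] by (simp add: z_def)
    next
      case False
      have "exp (- \<alpha>) * exp (- \<alpha> * (z + L)) \<le> \<Gamma> \<alpha> z"
      proof (cases "z \<ge> M\<^sub>1 + 1")
        case True
        have "\<alpha> * (z - M\<^sub>1) \<le> \<alpha> * (1 + (z + L))"
          by (rule mult_left_mono) (use M1 L \<alpha> in auto)
        then show ?thesis unfolding G(5)[OF True] by (simp add: algebra_simps flip: exp_add)
      next
        case False': False
        have "exp (- \<alpha>) * exp (- \<alpha> * (z + L)) \<le> exp (- \<alpha>) * 1"
          by (rule mult_left_mono) (use False \<alpha> in auto)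
        also have "\<dots> = \<Gamma> \<alpha> (M\<^sub>1 + 1)" using G(5)[of "M\<^sub>1 + 1"] by simp
        also have "\<dots> \<le> \<Gamma> \<alpha> z" using False' by (intro antimonoD[OF G(3)]) simp
        finally show ?thesis .
      qed
      then have low: "\<epsilon> * (exp (- \<alpha>) * exp (- \<alpha> * (z + L))) \<le> \<epsilon> * \<Gamma> \<alpha> z"
        by (rule mult_left_mono) (use \<epsilon> in simp)
      have "\<alpha> * (z + L) \<le> \<beta>\<^sub>0 * (z + L)" by (rule mult_right_mono) (use \<alpha> False in auto)
      have "C * exp (- \<beta>\<^sub>0 * (x - X t\<^sub>0)) = (C * exp (- \<beta>\<^sub>0 * d)) * exp (- \<beta>\<^sub>0 * (z + L))"
        by (simp add: z_def algebra_simps flip: exp_add)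
      also have "\<dots> \<le> (\<epsilon> * exp (- \<alpha>)) * exp (- \<alpha> * (z + L))"
        by (rule mult_mono[OF d]) (use \<open>\<alpha> * (z + L) \<le> \<beta>\<^sub>0 * (z + L)\<close> \<epsilon> in auto)
      finally have "C * exp (- \<beta>\<^sub>0 * (x - X t\<^sub>0)) \<le> \<epsilon> * \<Gamma> \<alpha> z" using low by simp
      moreover have "u t\<^sub>0 x \<le> u t\<^sub>0 (x - (L + d))" by (rule u_le) (use L d0 M1 in simp)
      ultimately show ?thesis using u\<^sub>0(2)[of x] by (simp add: z_def)
    qed
  qed
qed

text \<open>
  To the left of a fixed point \<open>N\<close> the datum is close to \<open>1\<close> and exceeds both \<open>1 - \<epsilon>\<close> and the front at the edge of the region
  where the weight is \<open>1\<close>.  To the right of \<open>N\<close> the shift is so large that only the tail of the front is left, which decays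
  at rate \<open>c_plus > \<alpha>\<close> and is therefore below the weight.
\<close>

lemma front_shifted_left_dominated:
  assumes weight: "weight_family M\<^sub>1 \<Gamma>" and \<alpha>: "0 < \<alpha>" "\<alpha> < c_plus" and \<epsilon>: "\<epsilon> > 0"
    and u\<^sub>0: "\<And>x. 0 \<le> u\<^sub>0 x" "(u\<^sub>0 \<longlongrightarrow> 1) at_bot"
  obtains \<zeta> where "\<And>x. u t\<^sub>0 (x - \<zeta>) - \<epsilon> * \<Gamma> \<alpha> (x - \<zeta> - X t\<^sub>0) \<le> u\<^sub>0 x"
proof -
  note G = weight_familyD[OF weight \<alpha>(1)]
  define l where "l = max (1 - \<epsilon>) (u t\<^sub>0 (X t\<^sub>0 - M\<^sub>1 - 1))"
  have "u t\<^sub>0 (X t\<^sub>0 - M\<^sub>1 - 1) < u t\<^sub>0 (X t\<^sub>0 - M\<^sub>1 - 2)" by (rule u_decreasing) simp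
  then have "l < 1" using u_range(2)[of t\<^sub>0 "X t\<^sub>0 - M\<^sub>1 - 2"] \<epsilon> by (simp add: l_def)
  then have "\<forall>\<^sub>F x in at_bot. l < u\<^sub>0 x" by (rule order_tendstoD[OF u\<^sub>0(2)])
  then obtain N where N: "\<And>x. x \<le> N \<Longrightarrow> l < u\<^sub>0 x"
    by (auto simp: eventually_at_bot_linorder)
  \<comment> \<open>From \<open>z\<^sub>0\<close> on, \<open>exp (- c_plus (z - h_plus)) \<le> \<epsilon> exp (- \<alpha> (z - M\<^sub>1))\<close>; the last entry solves this for \<open>z\<close>.\<close>
  define z\<^sub>0 where "z\<^sub>0 = max (max (M\<^sub>1 + 1) h_plus) ((c_plus * h_plus - \<alpha> * M\<^sub>1 - ln \<epsilon>) / (c_plus - \<alpha>))"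
  show thesis
  proof (rule that[of "N - X t\<^sub>0 - z\<^sub>0"])
    fix x
    define z where "z = x - (N - X t\<^sub>0 - z\<^sub>0) - X t\<^sub>0"
    have x_eq: "x - (N - X t\<^sub>0 - z\<^sub>0) = X t\<^sub>0 + z" by (simp add: z_def)
    have "u t\<^sub>0 (X t\<^sub>0 + z) - \<epsilon> * \<Gamma> \<alpha> z \<le> u\<^sub>0 x"
    proof (cases "x \<le> N")
      case True
      then have l: "1 - \<epsilon> \<le> u\<^sub>0 x" "u t\<^sub>0 (X t\<^sub>0 - M\<^sub>1 - 1) \<le> u\<^sub>0 x"
        using N[of x] by (auto simp: l_def)
      show ?thesis
      proof (cases "z \<le> - M\<^sub>1 - 1")
        case True
        then show ?thesis using l(1) G(4) u_range(2)[of t\<^sub>0 "X t\<^sub>0 + z"] by simp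
      next
        case False
        have "u t\<^sub>0 (X t\<^sub>0 + z) \<le> u t\<^sub>0 (X t\<^sub>0 - M\<^sub>1 - 1)" by (rule u_le) (use False in simp)
        moreover have "\<epsilon> * \<Gamma> \<alpha> z \<ge> 0" using G(1) \<epsilon> by simp
        ultimately show ?thesis using l(2) by linarith
      qed
    next
      case False
      then have z: "z \<ge> M\<^sub>1 + 1" "z \<ge> h_plus"
        "z \<ge> (c_plus * h_plus - \<alpha> * M\<^sub>1 - ln \<epsilon>) / (c_plus - \<alpha>)"
        by (auto simp: z_def z\<^sub>0_def)
      then have "c_plus * h_plus - \<alpha> * M\<^sub>1 - ln \<epsilon> \<le> z * (c_plus - \<alpha>)"
        using \<alpha>(2) by (simp add: pos_divide_le_eq)
      then have "- c_plus * (z - h_plus) \<le> ln \<epsilon> + - \<alpha> * (z - M\<^sub>1)" by (simp add: algebra_simps)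
      then have "exp (- c_plus * (z - h_plus)) \<le> exp (ln \<epsilon> + - \<alpha> * (z - M\<^sub>1))" by simp
      also have "\<dots> = \<epsilon> * \<Gamma> \<alpha> z" unfolding G(5)[OF z(1)] exp_add using \<epsilon> by simp
      finally have "exp (- c_plus * (z - h_plus)) \<le> \<epsilon> * \<Gamma> \<alpha> z" .
      moreover have "u t\<^sub>0 (X t\<^sub>0 + z) \<le> exp (- c_plus * (X t\<^sub>0 + z - X t\<^sub>0 - h_plus))"
        by (rule u_right) (use z(2) in simp)
      ultimately show ?thesis using u\<^sub>0(1)[of x] by simp
    qed
    then show "u t\<^sub>0 (x - (N - X t\<^sub>0 - z\<^sub>0))
        - \<epsilon> * \<Gamma> \<alpha> (x - (N - X t\<^sub>0 - z\<^sub>0) - X t\<^sub>0) \<le> u\<^sub>0 x"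
      unfolding x_eq by simp
  qed
qed

text \<open>
  The moving shifts of the local result stay within \<open>A \<epsilon> / \<omega>\<close> of their initial values; by monotonicity of the front
  they can be replaced by these limits, and the weight by \<open>1\<close>.
\<close>

lemma exponential_sandwich:
  assumes cutoff: "cutoff_width u X \<theta> \<theta>\<^sub>1 M\<^sub>1" and weight: "weight_family M\<^sub>1 \<Gamma>"
    and \<beta>\<^sub>0: "\<beta>\<^sub>0 > 0" and u\<^sub>0: "range u\<^sub>0 \<subseteq> {0..1}" "solves_ivp J f t\<^sub>0 u\<^sub>0 v" "(u\<^sub>0 \<longlongrightarrow> 1) at_bot"
    and C: "C > 0" "\<And>x. \<bar>u\<^sub>0 x - u t\<^sub>0 x\<bar> \<le> C * exp (- \<beta>\<^sub>0 * (x - X t\<^sub>0))"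
  shows "\<exists>\<omega>>0. \<exists>\<epsilon>\<^sub>1>0. \<forall>\<epsilon>. 0 < \<epsilon> \<and> \<epsilon> \<le> \<epsilon>\<^sub>1 \<longrightarrow>
        (\<exists>\<zeta>m \<zeta>p. \<forall>x. \<forall>t\<ge>t\<^sub>0.
          u t (x - \<zeta>m) - \<epsilon> * exp (- \<omega> * (t - t\<^sub>0)) \<le> v t x \<and>
          v t x \<le> u t (x - \<zeta>p) + \<epsilon> * exp (- \<omega> * (t - t\<^sub>0)))"
proof -
  obtain \<alpha>\<^sub>0 where \<alpha>\<^sub>0: "\<alpha>\<^sub>0 > 0" and trapping: "\<And>\<alpha>. 0 < \<alpha> \<Longrightarrow> \<alpha> \<le> \<alpha>\<^sub>0 \<Longrightarrow>
      \<exists>\<epsilon>\<^sub>0>0. \<exists>\<omega>>0. \<exists>A>0. one_sided_trapping (\<Gamma> \<alpha>) \<epsilon>\<^sub>0 \<omega> A"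
    using one_sided_stability[OF cutoff weight] by blast
  define \<alpha> where "\<alpha> = min \<alpha>\<^sub>0 (min \<beta>\<^sub>0 (c_plus / 2))"
  have \<alpha>: "0 < \<alpha>" "\<alpha> \<le> \<alpha>\<^sub>0" "\<alpha> \<le> \<beta>\<^sub>0" "\<alpha> < c_plus"
    using \<alpha>\<^sub>0 \<beta>\<^sub>0 constants_pos(4) by (auto simp: \<alpha>_def)
  note G = weight_familyD[OF weight \<alpha>(1)]
  obtain \<epsilon>\<^sub>0 \<omega> A where pos: "\<epsilon>\<^sub>0 > 0" "\<omega> > 0" "A > 0"
    and trap: "one_sided_trapping (\<Gamma> \<alpha>) \<epsilon>\<^sub>0 \<omega> A"
    using trapping[OF \<alpha>(1,2)] by blast
  have v: "solves_on J f {t\<^sub>0..} v" "v t\<^sub>0 = u\<^sub>0" using u\<^sub>0(2) by (auto simp: solves_ivp_def)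
  show ?thesis
  proof (rule exI[of _ \<omega>], rule conjI[OF pos(2)], rule exI[of _ \<epsilon>\<^sub>0], rule conjI[OF pos(1)],
      intro allI impI, elim conjE)
    fix \<epsilon> assume \<epsilon>: "0 < \<epsilon>" "\<epsilon> \<le> \<epsilon>\<^sub>0"
    have u0: "0 \<le> u\<^sub>0 x" "u\<^sub>0 x \<le> 1" for x using u\<^sub>0(1) by (auto simp: image_subset_iff)
    have above: "u\<^sub>0 x \<le> u t\<^sub>0 x + C * exp (- \<beta>\<^sub>0 * (x - X t\<^sub>0))" for x
      using C(2)[of x] by (simp add: abs_le_iff)
    obtain \<zeta>p where \<zeta>p: "\<And>x. u\<^sub>0 x \<le> u t\<^sub>0 (x - \<zeta>p) + \<epsilon> * \<Gamma> \<alpha> (x - \<zeta>p - X t\<^sub>0)"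
      using front_shifted_right_dominates[OF cutoff weight \<alpha>(1,3) \<epsilon>(1) C(1) u0(2) above] by blast
    obtain \<zeta>m where \<zeta>m: "\<And>x. u t\<^sub>0 (x - \<zeta>m) - \<epsilon> * \<Gamma> \<alpha> (x - \<zeta>m - X t\<^sub>0) \<le> u\<^sub>0 x"
      using front_shifted_left_dominated[OF weight \<alpha>(1,4) \<epsilon>(1) u0(1) u\<^sub>0(3)] by blast
    define e where "e t = A * \<epsilon> / \<omega> * (1 - exp (- \<omega> * (t - t\<^sub>0)))" for t
    have e: "e t \<le> A * \<epsilon> / \<omega>" for t
      unfolding e_def using pos \<epsilon>(1) by (intro mult_left_le) auto
    have weight_le: "\<epsilon> * exp (- \<omega> * (t - t\<^sub>0)) * \<Gamma> \<alpha> z \<le> \<epsilon> * exp (- \<omega> * (t - t\<^sub>0))" for t z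
      using G(1,2) \<epsilon>(1) by (intro mult_left_le) auto
    show "\<exists>\<zeta>m \<zeta>p. \<forall>x. \<forall>t\<ge>t\<^sub>0.
        u t (x - \<zeta>m) - \<epsilon> * exp (- \<omega> * (t - t\<^sub>0)) \<le> v t x \<and>
        v t x \<le> u t (x - \<zeta>p) + \<epsilon> * exp (- \<omega> * (t - t\<^sub>0))"
    proof (rule exI[of _ "\<zeta>m - A * \<epsilon> / \<omega>"], rule exI[of _ "\<zeta>p + A * \<epsilon> / \<omega>"], intro allI impI)
      fix x t assume t: "t\<^sub>0 \<le> t"
      note upper = one_sided_trappingD(1)[OF trap v(1) \<epsilon> t, unfolded v(2), OF \<zeta>p,
          of x, folded e_def]
      note lower = one_sided_trappingD(2)[OF trap v(1) \<epsilon> t, unfolded v(2), OF \<zeta>m,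
          of x, folded e_def]
      have "u t (x - (\<zeta>m - A * \<epsilon> / \<omega>)) \<le> u t (x - (\<zeta>m - e t))"
        "u t (x - (\<zeta>p + e t)) \<le> u t (x - (\<zeta>p + A * \<epsilon> / \<omega>))"
        using e[of t] by (auto intro!: u_le)
      then show "u t (x - (\<zeta>m - A * \<epsilon> / \<omega>)) - \<epsilon> * exp (- \<omega> * (t - t\<^sub>0)) \<le> v t x \<and>
        v t x \<le> u t (x - (\<zeta>p + A * \<epsilon> / \<omega>)) + \<epsilon> * exp (- \<omega> * (t - t\<^sub>0))"
        using upper lower weight_le[of t "x - (\<zeta>m - e t) - X t"] weight_le[of t "x - (\<zeta>p + e t) - X t"]
        by linarith
    qed
  qed
qed

end

section \<open>Stability of the transition front\<close>

theorem theorem1p4: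
  fixes J :: "real \<Rightarrow> real"
    and f ft fu fuu :: "real \<Rightarrow> real \<Rightarrow> real"
    and fmin fmin' fmax :: "real \<Rightarrow> real"
    and \<theta> \<theta>\<^sub>1 \<beta>\<^sub>1 :: real
    and c_star :: real and \<phi> :: "real \<Rightarrow> real" and y :: "real \<Rightarrow> real"
    and us :: "real \<Rightarrow> real \<Rightarrow> real \<Rightarrow> real"
    and Xs dXs ddXs :: "real \<Rightarrow> real \<Rightarrow> real"
    and c_min c_max c_minus c_plus h_minus h_plus :: real
    and sn :: "nat \<Rightarrow> real"
    and u :: "real \<Rightarrow> real \<Rightarrow> real" and X :: "real \<Rightarrow> real"
    and M\<^sub>1 :: real and \<Gamma> :: "real \<Rightarrow> real \<Rightarrow> real"
  assumes front: "limiting_front J f ft fu fuu fmin fmin' fmax \<theta> \<theta>\<^sub>1 \<beta>\<^sub>1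
      c_star \<phi> y us Xs dXs ddXs c_min c_max c_minus c_plus h_minus h_plus sn u X"
    and M\<^sub>1: "cutoff_width u X \<theta> \<theta>\<^sub>1 M\<^sub>1"
    and \<Gamma>: "weight_family M\<^sub>1 \<Gamma>"
  shows
   "(\<exists>\<alpha>\<^sub>0>0. \<forall>\<alpha>. 0 < \<alpha> \<and> \<alpha> \<le> \<alpha>\<^sub>0 \<longrightarrow>
      (\<exists>\<epsilon>\<^sub>0>0. \<exists>\<omega>>0. \<exists>A>0.
        \<forall>u\<^sub>0 v t\<^sub>0 \<epsilon> \<zeta>\<^sub>0m \<zeta>\<^sub>0p.
          u\<^sub>0 \<in> BUC \<and> range u\<^sub>0 \<subseteq> {0..1} \<and> solves_ivp J f t\<^sub>0 u\<^sub>0 v \<and> 0 < \<epsilon> \<and> \<epsilon> \<le> \<epsilon>\<^sub>0 \<and>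
          (\<forall>x. u t\<^sub>0 (x - \<zeta>\<^sub>0m) - \<epsilon> * \<Gamma> \<alpha> (x - \<zeta>\<^sub>0m - X t\<^sub>0) \<le> u\<^sub>0 x \<and>
               u\<^sub>0 x \<le> u t\<^sub>0 (x - \<zeta>\<^sub>0p) + \<epsilon> * \<Gamma> \<alpha> (x - \<zeta>\<^sub>0p - X t\<^sub>0))
          \<longrightarrow>
          (let \<zeta>m = (\<lambda>t. \<zeta>\<^sub>0m - A * \<epsilon> / \<omega> * (1 - exp (- \<omega> * (t - t\<^sub>0))));
               \<zeta>p = (\<lambda>t. \<zeta>\<^sub>0p + A * \<epsilon> / \<omega> * (1 - exp (- \<omega> * (t - t\<^sub>0))));
               q = (\<lambda>t. \<epsilon> * exp (- \<omega> * (t - t\<^sub>0)))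
           in \<forall>x. \<forall>t\<ge>t\<^sub>0.
                u t (x - \<zeta>m t) - q t * \<Gamma> \<alpha> (x - \<zeta>m t - X t) \<le> v t x \<and>
                v t x \<le> u t (x - \<zeta>p t) + q t * \<Gamma> \<alpha> (x - \<zeta>p t - X t))))
    \<and>
    (\<forall>\<beta>\<^sub>0>0. \<forall>t\<^sub>0 u\<^sub>0 v.
      u\<^sub>0 \<in> BUC \<and> range u\<^sub>0 \<subseteq> {0..1} \<and> solves_ivp J f t\<^sub>0 u\<^sub>0 v \<and> (u\<^sub>0 \<longlongrightarrow> 1) at_bot \<and>
      (\<exists>C>0. \<forall>x. \<bar>u\<^sub>0 x - u t\<^sub>0 x\<bar> \<le> C * exp (- \<beta>\<^sub>0 * (x - X t\<^sub>0)))
      \<longrightarrow>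
      (\<exists>\<omega>>0. \<exists>\<epsilon>\<^sub>1>0. \<forall>\<epsilon>. 0 < \<epsilon> \<and> \<epsilon> \<le> \<epsilon>\<^sub>1 \<longrightarrow>
        (\<exists>\<zeta>m \<zeta>p. \<forall>x. \<forall>t\<ge>t\<^sub>0.
          u t (x - \<zeta>m) - \<epsilon> * exp (- \<omega> * (t - t\<^sub>0)) \<le> v t x \<and>
          v t x \<le> u t (x - \<zeta>p) + \<epsilon> * exp (- \<omega> * (t - t\<^sub>0)))))"
proof -
  interpret limiting_front J f ft fu fuu fmin fmin' fmax \<theta> \<theta>\<^sub>1 \<beta>\<^sub>1
      c_star \<phi> y us Xs dXs ddXs c_min c_max c_minus c_plus h_minus h_plus sn u X
    by (rule front)
  obtain \<alpha>\<^sub>0 where \<alpha>\<^sub>0: "\<alpha>\<^sub>0 > 0" and trapping: "\<And>\<alpha>. 0 < \<alpha> \<Longrightarrow> \<alpha> \<le> \<alpha>\<^sub>0 \<Longrightarrow>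
      \<exists>\<epsilon>\<^sub>0>0. \<exists>\<omega>>0. \<exists>A>0. one_sided_trapping (\<Gamma> \<alpha>) \<epsilon>\<^sub>0 \<omega> A"
    using one_sided_stability[OF M\<^sub>1 \<Gamma>] by blast
  show ?thesis
  proof (rule conjI)
    show "\<exists>\<alpha>\<^sub>0>0. \<forall>\<alpha>. 0 < \<alpha> \<and> \<alpha> \<le> \<alpha>\<^sub>0 \<longrightarrow>
      (\<exists>\<epsilon>\<^sub>0>0. \<exists>\<omega>>0. \<exists>A>0.
        \<forall>u\<^sub>0 v t\<^sub>0 \<epsilon> \<zeta>\<^sub>0m \<zeta>\<^sub>0p.
          u\<^sub>0 \<in> BUC \<and> range u\<^sub>0 \<subseteq> {0..1} \<and> solves_ivp J f t\<^sub>0 u\<^sub>0 v \<and> 0 < \<epsilon> \<and> \<epsilon> \<le> \<epsilon>\<^sub>0 \<and>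
          (\<forall>x. u t\<^sub>0 (x - \<zeta>\<^sub>0m) - \<epsilon> * \<Gamma> \<alpha> (x - \<zeta>\<^sub>0m - X t\<^sub>0) \<le> u\<^sub>0 x \<and>
               u\<^sub>0 x \<le> u t\<^sub>0 (x - \<zeta>\<^sub>0p) + \<epsilon> * \<Gamma> \<alpha> (x - \<zeta>\<^sub>0p - X t\<^sub>0))
          \<longrightarrow>
          (let \<zeta>m = (\<lambda>t. \<zeta>\<^sub>0m - A * \<epsilon> / \<omega> * (1 - exp (- \<omega> * (t - t\<^sub>0))));
               \<zeta>p = (\<lambda>t. \<zeta>\<^sub>0p + A * \<epsilon> / \<omega> * (1 - exp (- \<omega> * (t - t\<^sub>0))));
               q = (\<lambda>t. \<epsilon> * exp (- \<omega> * (t - t\<^sub>0)))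
           in \<forall>x. \<forall>t\<ge>t\<^sub>0.
                u t (x - \<zeta>m t) - q t * \<Gamma> \<alpha> (x - \<zeta>m t - X t) \<le> v t x \<and>
                v t x \<le> u t (x - \<zeta>p t) + q t * \<Gamma> \<alpha> (x - \<zeta>p t - X t)))"
    proof (rule exI[of _ \<alpha>\<^sub>0], intro conjI \<alpha>\<^sub>0 allI impI)
      fix \<alpha> assume "0 < \<alpha> \<and> \<alpha> \<le> \<alpha>\<^sub>0"
      then obtain \<epsilon>\<^sub>0 \<omega> A where pos: "\<epsilon>\<^sub>0 > 0" "\<omega> > 0" "A > 0"
        and trap: "one_sided_trapping (\<Gamma> \<alpha>) \<epsilon>\<^sub>0 \<omega> A"
        using trapping by blast
      show "\<exists>\<epsilon>\<^sub>0>0. \<exists>\<omega>>0. \<exists>A>0.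
        \<forall>u\<^sub>0 v t\<^sub>0 \<epsilon> \<zeta>\<^sub>0m \<zeta>\<^sub>0p.
          u\<^sub>0 \<in> BUC \<and> range u\<^sub>0 \<subseteq> {0..1} \<and> solves_ivp J f t\<^sub>0 u\<^sub>0 v \<and> 0 < \<epsilon> \<and> \<epsilon> \<le> \<epsilon>\<^sub>0 \<and>
          (\<forall>x. u t\<^sub>0 (x - \<zeta>\<^sub>0m) - \<epsilon> * \<Gamma> \<alpha> (x - \<zeta>\<^sub>0m - X t\<^sub>0) \<le> u\<^sub>0 x \<and>
               u\<^sub>0 x \<le> u t\<^sub>0 (x - \<zeta>\<^sub>0p) + \<epsilon> * \<Gamma> \<alpha> (x - \<zeta>\<^sub>0p - X t\<^sub>0))
          \<longrightarrow>
          (let \<zeta>m = (\<lambda>t. \<zeta>\<^sub>0m - A * \<epsilon> / \<omega> * (1 - exp (- \<omega> * (t - t\<^sub>0))));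
               \<zeta>p = (\<lambda>t. \<zeta>\<^sub>0p + A * \<epsilon> / \<omega> * (1 - exp (- \<omega> * (t - t\<^sub>0))));
               q = (\<lambda>t. \<epsilon> * exp (- \<omega> * (t - t\<^sub>0)))
           in \<forall>x. \<forall>t\<ge>t\<^sub>0.
                u t (x - \<zeta>m t) - q t * \<Gamma> \<alpha> (x - \<zeta>m t - X t) \<le> v t x \<and>
                v t x \<le> u t (x - \<zeta>p t) + q t * \<Gamma> \<alpha> (x - \<zeta>p t - X t))"
      proof (rule exI[of _ \<epsilon>\<^sub>0], rule conjI[OF pos(1)], rule exI[of _ \<omega>], rule conjI[OF pos(2)],
          rule exI[of _ A], rule conjI[OF pos(3)], intro allI impI, elim conjE,
          unfold Let_def solves_ivp_def, elim conjE, intro allI impI)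
        fix u\<^sub>0 v t\<^sub>0 \<epsilon> \<zeta>\<^sub>0m \<zeta>\<^sub>0p x t
        assume v: "solves_on J f {t\<^sub>0..} v" "v t\<^sub>0 = u\<^sub>0" and \<epsilon>: "0 < \<epsilon>" "\<epsilon> \<le> \<epsilon>\<^sub>0" and t: "t\<^sub>0 \<le> t"
          and init: "\<forall>x. u t\<^sub>0 (x - \<zeta>\<^sub>0m) - \<epsilon> * \<Gamma> \<alpha> (x - \<zeta>\<^sub>0m - X t\<^sub>0) \<le> u\<^sub>0 x \<and>
            u\<^sub>0 x \<le> u t\<^sub>0 (x - \<zeta>\<^sub>0p) + \<epsilon> * \<Gamma> \<alpha> (x - \<zeta>\<^sub>0p - X t\<^sub>0)"
        have "v t\<^sub>0 x \<le> u t\<^sub>0 (x - \<zeta>\<^sub>0p) + \<epsilon> * \<Gamma> \<alpha> (x - \<zeta>\<^sub>0p - X t\<^sub>0)" for x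
          using init v(2) by blast
        note upper = one_sided_trappingD(1)[OF trap v(1) \<epsilon> t this]
        have "u t\<^sub>0 (x - \<zeta>\<^sub>0m) - \<epsilon> * \<Gamma> \<alpha> (x - \<zeta>\<^sub>0m - X t\<^sub>0) \<le> v t\<^sub>0 x" for x
          using init v(2) by blast
        note lower = one_sided_trappingD(2)[OF trap v(1) \<epsilon> t this]
        show "u t (x - (\<zeta>\<^sub>0m - A * \<epsilon> / \<omega> * (1 - exp (- \<omega> * (t - t\<^sub>0)))))
            - \<epsilon> * exp (- \<omega> * (t - t\<^sub>0))
              * \<Gamma> \<alpha> (x - (\<zeta>\<^sub>0m - A * \<epsilon> / \<omega> * (1 - exp (- \<omega> * (t - t\<^sub>0)))) - X t) \<le> v t x \<and>
          v t x \<le> u t (x - (\<zeta>\<^sub>0p + A * \<epsilon> / \<omega> * (1 - exp (- \<omega> * (t - t\<^sub>0)))))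
            + \<epsilon> * exp (- \<omega> * (t - t\<^sub>0))
              * \<Gamma> \<alpha> (x - (\<zeta>\<^sub>0p + A * \<epsilon> / \<omega> * (1 - exp (- \<omega> * (t - t\<^sub>0)))) - X t)"
          by (rule conjI[OF lower upper])
      qed
    qed
    show "\<forall>\<beta>\<^sub>0>0. \<forall>t\<^sub>0 u\<^sub>0 v.
      u\<^sub>0 \<in> BUC \<and> range u\<^sub>0 \<subseteq> {0..1} \<and> solves_ivp J f t\<^sub>0 u\<^sub>0 v \<and> (u\<^sub>0 \<longlongrightarrow> 1) at_bot \<and>
      (\<exists>C>0. \<forall>x. \<bar>u\<^sub>0 x - u t\<^sub>0 x\<bar> \<le> C * exp (- \<beta>\<^sub>0 * (x - X t\<^sub>0)))
      \<longrightarrow>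
      (\<exists>\<omega>>0. \<exists>\<epsilon>\<^sub>1>0. \<forall>\<epsilon>. 0 < \<epsilon> \<and> \<epsilon> \<le> \<epsilon>\<^sub>1 \<longrightarrow>
        (\<exists>\<zeta>m \<zeta>p. \<forall>x. \<forall>t\<ge>t\<^sub>0.
          u t (x - \<zeta>m) - \<epsilon> * exp (- \<omega> * (t - t\<^sub>0)) \<le> v t x \<and>
          v t x \<le> u t (x - \<zeta>p) + \<epsilon> * exp (- \<omega> * (t - t\<^sub>0))))"
    proof (intro allI impI, elim conjE exE)
      fix \<beta>\<^sub>0 t\<^sub>0 C :: real and u\<^sub>0 v
      assume "\<beta>\<^sub>0 > 0" "u\<^sub>0 \<in> BUC" "range u\<^sub>0 \<subseteq> {0..1}" "solves_ivp J f t\<^sub>0 u\<^sub>0 v" "(u\<^sub>0 \<longlongrightarrow> 1) at_bot"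
        "C > 0" "\<forall>x. \<bar>u\<^sub>0 x - u t\<^sub>0 x\<bar> \<le> C * exp (- \<beta>\<^sub>0 * (x - X t\<^sub>0))"
      then show "\<exists>\<omega>>0. \<exists>\<epsilon>\<^sub>1>0. \<forall>\<epsilon>. 0 < \<epsilon> \<and> \<epsilon> \<le> \<epsilon>\<^sub>1 \<longrightarrow>
        (\<exists>\<zeta>m \<zeta>p. \<forall>x. \<forall>t\<ge>t\<^sub>0.
          u t (x - \<zeta>m) - \<epsilon> * exp (- \<omega> * (t - t\<^sub>0)) \<le> v t x \<and>
          v t x \<le> u t (x - \<zeta>p) + \<epsilon> * exp (- \<omega> * (t - t\<^sub>0)))"
        by (intro exponential_sandwich[OF M\<^sub>1 \<Gamma>, of \<beta>\<^sub>0 u\<^sub>0 t\<^sub>0 v C]) simp_all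
    qed
  qed
qed

end
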